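(* The automata group $\mathcal G(\mathcal C(Q_8))$ and, for every $n\ge 3$, the automata group $\mathcal G(\mathcal C(M_{2^n}))$ are linear over $\mathbb Z_2[t^{\pm1}]$; that is, each of them embeds into $\mathrm{GL}_d(\mathbb Z_2[t^{\pm 1}])$ for some positive integer $d$.
   Context: $\mathbb Z_2=\mathbb Z/2\mathbb Z$ and $\mathbb Z_2[t^{\pm1}]$ is the Laurent polynomial ring. $Q_8$ is the quaternion group of order $8$. For $n\ge3$, $M_{2^n}=\langle a,b\mid a^{2^{n-1}}=b^2=e,\ bab^{-1}=a^{2^{n-2}+1}\rangle$ is the Iwasawa/modular group of order $2^n$. Cayley machine: for a non-trivial finite group $G$, the Cayley machine $\mathcal C(G)$ is the automaton with state set $G$ and alphabet $G$ which, in state $g_0$ on reading input letter $g$, moves to state $g_0g$ and outputs $g_0g$. Each state $g\in G$ defines a bijection $\mathcal C(G)_g$ of the set $G^\omega$ of right-infinite words over $G$, namely $\mathcal C(G)_g(a_0,a_1,a_2,\ldots)=(ga_0,\,ga_0a_1,\,ga_0a_1a_2,\ldots)$. The automata group $\mathcal G(\mathcal C(G))$ is the group of bijections of $G^\omega$ generated by all $\mathcal C(G)_g$, $g\in G$, with product given by composition. *)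

theory Defs
  imports
    "HOL-Algebra.Bij"
    "HOL-Algebra.Generated_Groups"
    "HOL-Library.Z2"
    "HOL-Library.Poly_Mapping"
    "Jordan_Normal_Form.Matrix"
begin

section \<open>Automata groups\<close>

text \<open>Letter-to-letter transducers with equal input and output alphabet.\<close>

record ('q, 'a) mealy =
  states :: "'q set"
  alphabet :: "'a set"
  next_state :: "'q \<Rightarrow> 'a \<Rightarrow> 'q"
  out_letter :: "'q \<Rightarrow> 'a \<Rightarrow> 'a"

text \<open>Right-infinite words over \<open>A\<close>, indexed from \<open>0\<close>.\<close>

definition omega_words :: "'a set \<Rightarrow> (nat \<Rightarrow> 'a) set" where
  "omega_words A = {w. range w \<subseteq> A}"

primrec state_after :: "('q, 'a) mealy \<Rightarrow> 'q \<Rightarrow> (nat \<Rightarrow> 'a) \<Rightarrow> nat \<Rightarrow> 'q" where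
  "state_after M q w 0 = q"
| "state_after M q w (Suc n) = next_state M (state_after M q w n) (w n)"

definition state_action :: "('q, 'a) mealy \<Rightarrow> 'q \<Rightarrow> (nat \<Rightarrow> 'a) \<Rightarrow> (nat \<Rightarrow> 'a)" where
  "state_action M q = (\<lambda>w \<in> omega_words (alphabet M). \<lambda>n. out_letter M (state_after M q w n) (w n))"

text \<open>Meaningful only if every state acts bijectively; for Cayley machines this is
  \<open>state_action_cayley_Bij\<close> below.\<close>

definition automata_group :: "('q, 'a) mealy \<Rightarrow> ((nat \<Rightarrow> 'a) \<Rightarrow> (nat \<Rightarrow> 'a)) monoid" where
  "automata_group M =
    (let S = BijGroup (omega_words (alphabet M))
     in S\<lparr>carrier := generate S (state_action M ` states M)\<rparr>)"

definition cayley_machine :: "('a, 'b) monoid_scheme \<Rightarrow> ('a, 'a) mealy" where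
  "cayley_machine G =
    \<lparr>states = carrier G, alphabet = carrier G,
     next_state = (\<lambda>g x. g \<otimes>\<^bsub>G\<^esub> x), out_letter = (\<lambda>g x. g \<otimes>\<^bsub>G\<^esub> x)\<rparr>"

lemma state_action_cayley:
  assumes "w \<in> omega_words (carrier G)"
  shows "state_action (cayley_machine G) g w 0 = g \<otimes>\<^bsub>G\<^esub> w 0"
    and "state_action (cayley_machine G) g w (Suc n) =
           state_action (cayley_machine G) g w n \<otimes>\<^bsub>G\<^esub> w (Suc n)"
  using assms by (simp_all add: state_action_def cayley_machine_def)

lemma (in group) state_action_cayley_Bij:
  assumes g: "g \<in> carrier G"
  shows "state_action (cayley_machine G) g \<in> Bij (omega_words (carrier G))"
proof -
  let ?W = "omega_words (carrier G)" and ?f = "state_action (cayley_machine G) g"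
  have W: "w n \<in> carrier G" if "w \<in> ?W" for w n
    using that by (auto simp: omega_words_def)
  have cl: "?f w n \<in> carrier G" if w: "w \<in> ?W" for w n
    by (induction n) (simp_all add: state_action_cayley[OF w] g W[OF w])
  have into: "?f w \<in> ?W" if "w \<in> ?W" for w
    using cl[OF that] by (auto simp: omega_words_def)
  have inj: "inj_on ?f ?W"
  proof (rule inj_onI)
    fix v w assume v: "v \<in> ?W" and w: "w \<in> ?W" and eq: "?f v = ?f w"
    show "v = w"
    proof
      fix n show "v n = w n"
      proof (cases n)
        case 0
        have "g \<otimes> v 0 = g \<otimes> w 0"
          using fun_cong[OF eq, of 0] by (simp add: state_action_cayley v w)
        then show ?thesis using 0 g W v w by simp
      next
        case (Suc m)
        have "?f v m \<otimes> v (Suc m) = ?f v m \<otimes> w (Suc m)"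
          using fun_cong[OF eq, of "Suc m"] fun_cong[OF eq, of m]
          by (simp add: state_action_cayley v w)
        then show ?thesis using Suc cl W v w by simp
      qed
    qed
  qed
  have surj: "u \<in> ?f ` ?W" if u: "u \<in> ?W" for u
  proof -
    define w where "w n = (case n of 0 \<Rightarrow> inv g \<otimes> u 0 | Suc m \<Rightarrow> inv (u m) \<otimes> u (Suc m))" for n
    have w: "w \<in> ?W"
      using g W[OF u] by (auto simp: omega_words_def w_def split: nat.split)
    have w_0: "w 0 = inv g \<otimes> u 0" and w_Suc: "w (Suc n) = inv (u n) \<otimes> u (Suc n)" for n
      by (simp_all add: w_def)
    have "?f w n = u n" for n
    proof (induction n)
      case 0
      show ?case using g W[OF u]
        by (simp add: state_action_cayley[OF w] w_0 m_assoc[symmetric])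
    next
      case (Suc n)
      then show ?case using W[OF u]
        by (simp add: state_action_cayley[OF w] w_Suc m_assoc[symmetric])
    qed
    then have "?f w = u"
      by (rule ext)
    then show ?thesis using w by blast
  qed
  have "bij_betw ?f ?W ?W"
    unfolding bij_betw_def using inj into surj by blast
  moreover have "?f \<in> extensional ?W"
    by (simp add: state_action_def cayley_machine_def)
  ultimately show ?thesis by (simp add: Bij_def)
qed


section \<open>The quaternion group of order 8\<close>

text \<open>The signed units \<open>\<plusminus>1, \<plusminus>i, \<plusminus>j, \<plusminus>k\<close>; the pair \<open>(s, u)\<close> is \<open>-u\<close> if \<open>s\<close> holds and \<open>u\<close> otherwise.\<close>

datatype quat_unit = Q1 | QI | QJ | QK

fun quat_unit_mult :: "quat_unit \<Rightarrow> quat_unit \<Rightarrow> bool \<times> quat_unit" where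
  "quat_unit_mult Q1 y = (False, y)"
| "quat_unit_mult x Q1 = (False, x)"
| "quat_unit_mult QI QI = (True, Q1)"
| "quat_unit_mult QJ QJ = (True, Q1)"
| "quat_unit_mult QK QK = (True, Q1)"
| "quat_unit_mult QI QJ = (False, QK)"
| "quat_unit_mult QJ QK = (False, QI)"
| "quat_unit_mult QK QI = (False, QJ)"
| "quat_unit_mult QJ QI = (True, QK)"
| "quat_unit_mult QK QJ = (True, QI)"
| "quat_unit_mult QI QK = (True, QJ)"

definition quaternion_group :: "(bool \<times> quat_unit) monoid" where
  "quaternion_group =
    \<lparr>carrier = UNIV,
     monoid.mult = (\<lambda>(s, x) (t, y). case quat_unit_mult x y of (r, z) \<Rightarrow> ((s \<noteq> t) \<noteq> r, z)),
     one = (False, Q1)\<rparr>"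

lemma UNIV_quat_unit: "UNIV = {Q1, QI, QJ, QK}"
  using quat_unit.exhaust by blast

lemma group_quaternion_group: "group quaternion_group"
proof (rule groupI)
  fix x y z :: "bool \<times> quat_unit"
  obtain s u where x: "x = (s, u)" by fastforce
  obtain t v where y: "y = (t, v)" by fastforce
  obtain r w where z: "z = (r, w)" by fastforce
  show "x \<otimes>\<^bsub>quaternion_group\<^esub> y \<otimes>\<^bsub>quaternion_group\<^esub> z =
        x \<otimes>\<^bsub>quaternion_group\<^esub> (y \<otimes>\<^bsub>quaternion_group\<^esub> z)"
    unfolding x y z by (cases u; cases v; cases w) (auto simp: quaternion_group_def)
  show "\<one>\<^bsub>quaternion_group\<^esub> \<otimes>\<^bsub>quaternion_group\<^esub> x = x"
    by (auto simp: quaternion_group_def x)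
  have "(s \<noteq> (u \<noteq> Q1), u) \<otimes>\<^bsub>quaternion_group\<^esub> x = \<one>\<^bsub>quaternion_group\<^esub>"
    by (cases u) (auto simp: quaternion_group_def x)
  then show "\<exists>y\<in>carrier quaternion_group. y \<otimes>\<^bsub>quaternion_group\<^esub> x = \<one>\<^bsub>quaternion_group\<^esub>"
    by (auto simp: quaternion_group_def)
qed (auto simp: quaternion_group_def)

lemma order_quaternion_group: "order quaternion_group = 8"
proof -
  have "order quaternion_group = card (UNIV \<times> {Q1, QI, QJ, QK} :: (bool \<times> quat_unit) set)"
    unfolding order_def quaternion_group_def UNIV_quat_unit[symmetric] by simp
  then show ?thesis by (simp add: card_cartesian_product)
qed


section \<open>Groups given by generators and relations\<close>

text \<open>A group word is a list of letters \<open>(s, b)\<close>, standing for the generator \<open>s\<close> if \<open>b\<close> holds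
  and for its formal inverse otherwise. Every element of the type \<open>'s\<close> is a generator;
  a pair \<open>(u, v)\<close> in \<open>R\<close> is the relation \<open>u = v\<close>.\<close>

type_synonym 's group_word = "('s \<times> bool) list"

inductive word_eq :: "('s group_word \<times> 's group_word) set \<Rightarrow> 's group_word \<Rightarrow> 's group_word \<Rightarrow> bool"
  for R where
  relation: "(u, v) \<in> R \<Longrightarrow> word_eq R u v"
| cancel: "word_eq R [(s, b), (s, \<not> b)] []"
| refl: "word_eq R u u"
| sym: "word_eq R u v \<Longrightarrow> word_eq R v u"
| trans: "word_eq R u v \<Longrightarrow> word_eq R v w \<Longrightarrow> word_eq R u w"
| append: "word_eq R u u' \<Longrightarrow> word_eq R v v' \<Longrightarrow> word_eq R (u @ v) (u' @ v')"

definition word_rel :: "('s group_word \<times> 's group_word) set \<Rightarrow> ('s group_word \<times> 's group_word) set" where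
  "word_rel R = {(u, v). word_eq R u v}"

definition presented_group :: "('s group_word \<times> 's group_word) set \<Rightarrow> 's group_word set monoid" where
  "presented_group R =
    \<lparr>carrier = UNIV // word_rel R,
     monoid.mult = (\<lambda>X Y. \<Union>u\<in>X. \<Union>v\<in>Y. word_rel R `` {u @ v}),
     one = word_rel R `` {[]}\<rparr>"

lemma equiv_word_rel: "equiv UNIV (word_rel R)"
  by (rule equivI)
    (auto simp: word_rel_def refl_on_def sym_def trans_def intro: word_eq.intros)

lemma presented_group_mult:
  "word_rel R `` {u} \<otimes>\<^bsub>presented_group R\<^esub> word_rel R `` {v} = word_rel R `` {u @ v}"
proof -
  have "congruent2 (word_rel R) (word_rel R) (\<lambda>u v. word_rel R `` {u @ v})"
    by (rule congruent2I')
       (metis (mono_tags, lifting) case_prod_conv equiv_class_eq_iff equiv_word_rel UNIV_I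
          mem_Collect_eq word_eq.append word_rel_def)
  then show ?thesis
    by (simp add: presented_group_def UN_equiv_class2[OF equiv_word_rel equiv_word_rel])
qed

lemma word_eq_inverse: "word_eq R (rev (map (\<lambda>(s, b). (s, \<not> b)) u) @ u) []"
proof (induction u)
  case (Cons x u)
  obtain s b where x: "x = (s, b)" by fastforce
  let ?i = "rev (map (\<lambda>(s, b). (s, \<not> b)) u)"
  have "word_eq R [(s, \<not> b), (s, b)] []"
    using word_eq.cancel[of R s "\<not> b"] by simp
  then have "word_eq R (?i @ [(s, \<not> b), (s, b)] @ u) (?i @ [] @ u)"
    by (intro word_eq.append word_eq.refl)
  then have "word_eq R (?i @ [(s, \<not> b), (s, b)] @ u) []"
    using Cons by (auto intro: word_eq.trans)
  then show ?case by (simp add: x)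
qed (simp add: word_eq.refl)

lemma group_presented_group: "group (presented_group R)"
proof (rule groupI)
  have cls: "\<exists>u. X = word_rel R `` {u}" if "X \<in> carrier (presented_group R)" for X
    using that by (auto simp: presented_group_def quotient_def)
  have mem: "word_rel R `` {u} \<in> carrier (presented_group R)" for u
    by (auto simp: presented_group_def quotient_def)
  show "\<one>\<^bsub>presented_group R\<^esub> \<in> carrier (presented_group R)"
    using mem[of "[]"] by (simp add: presented_group_def)
  fix X assume X: "X \<in> carrier (presented_group R)"
  then obtain u where u: "X = word_rel R `` {u}" using cls by blast
  show "\<one>\<^bsub>presented_group R\<^esub> \<otimes>\<^bsub>presented_group R\<^esub> X = X"
    using presented_group_mult[of R "[]" u] by (simp add: u presented_group_def)
  have "word_rel R `` {rev (map (\<lambda>(s, b). (s, \<not> b)) u) @ u} = word_rel R `` {[]}"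
    by (rule equiv_class_eq[OF equiv_word_rel]) (simp add: word_rel_def word_eq_inverse)
  then show "\<exists>Y\<in>carrier (presented_group R). Y \<otimes>\<^bsub>presented_group R\<^esub> X = \<one>\<^bsub>presented_group R\<^esub>"
    using mem by (metis u presented_group_mult presented_group_def monoid.select_convs(2))
  fix Y assume Y: "Y \<in> carrier (presented_group R)"
  then obtain v where v: "Y = word_rel R `` {v}" using cls by blast
  show "X \<otimes>\<^bsub>presented_group R\<^esub> Y \<in> carrier (presented_group R)"
    by (simp add: u v presented_group_mult mem)
  fix Z assume "Z \<in> carrier (presented_group R)"
  then obtain w where w: "Z = word_rel R `` {w}" using cls by blast
  show "X \<otimes>\<^bsub>presented_group R\<^esub> Y \<otimes>\<^bsub>presented_group R\<^esub> Z =
        X \<otimes>\<^bsub>presented_group R\<^esub> (Y \<otimes>\<^bsub>presented_group R\<^esub> Z)"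
    by (simp add: u v w presented_group_mult)
qed


section \<open>The modular groups of order \<open>2\<^sup>n\<close>\<close>

datatype modular_gen = Gen_a | Gen_b

text \<open>For \<open>n \<ge> 3\<close> this is the group with generators \<open>a, b\<close> and relations
  \<open>a ^ (2 ^ (n - 1)) = e\<close>, \<open>b ^ 2 = e\<close>, \<open>b a b\<inverse> = a ^ (2 ^ (n - 2) + 1)\<close>. The exponents use truncated
  subtraction, so smaller \<open>n\<close> are not meaningful.\<close>

definition modular_group :: "nat \<Rightarrow> modular_gen group_word set monoid" where
  "modular_group n = presented_group
    {(replicate (2 ^ (n - 1)) (Gen_a, True), []),
     (replicate 2 (Gen_b, True), []),
     ([(Gen_b, True), (Gen_a, True), (Gen_b, False)], replicate (2 ^ (n - 2) + 1) (Gen_a, True))}"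


section \<open>Linearity\<close>

text \<open>Laurent polynomials over \<open>R\<close> as the group ring of the integers: finitely supported
  coefficient functions with the convolution product, the exponent of \<open>t\<close> being the index.\<close>

type_synonym 'r laurent_poly = "int \<Rightarrow>\<^sub>0 'r"

text \<open>The group of units of the ring of \<open>d \<times> d\<close> matrices.\<close>

definition general_linear :: "'r::comm_ring_1 itself \<Rightarrow> nat \<Rightarrow> 'r mat monoid" where
  "general_linear R d = units_of (ring_mat R d ())"

definition linear_over :: "'r::comm_ring_1 itself \<Rightarrow> ('g, 'b) monoid_scheme \<Rightarrow> bool" where
  "linear_over R G \<longleftrightarrow> (\<exists>d>0. \<exists>\<phi>. \<phi> \<in> mon G (general_linear R d))"

end

theory Submission
  imports Defs
begin

text \<open>
  Let \<open>x\<close> be the state \<open>e\<close> of the Cayley machine and \<open>\<alpha>\<^sub>g\<close> the left multiplication of the first letter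
  by \<open>g\<close>; state \<open>g\<close> acts as \<open>x \<alpha>\<^sub>g\<close>. If \<open>G\<close> is generated by \<open>a, b\<close> and its commutators lie in a central
  subgroup \<open>{e, z}\<close> of order two, the conjugates of \<open>\<alpha>\<^sub>g, \<alpha>\<^sub>h\<close> by \<open>x\<^sup>m, x\<^sup>n\<close> have as commutator the
  conjugate of \<open>\<alpha>\<close> at \<open>[g, h]\<close> by \<open>x\<close> to the power \<open>\<lfloor>(m + n) / 2\<rfloor>\<close>: the group is a ``cross-wired''
  lamplighter. These relations bring every word in \<open>x, \<alpha>\<^sub>a, \<alpha>\<^sub>b\<close> to a normal form, and in any group that
  satisfies them a normal form can only be trivial for the obvious reason as soon as the conjugates of
  \<open>\<alpha>\<^sub>z\<close> are linearly independent over \<open>\<int>/2\<close>. So it suffices to find matrices over \<open>\<int>\<^sub>2[t\<^sup>\<plusminus>\<^sup>1]\<close> with the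
  same relations and the same independence.
\<close>

text \<open>Both families fit one scheme: z = a^L with L a power of two, b a = z a b, and b^2 is z
  or e, as the flag \<epsilon> says. \<open>Q_8\<close> has L = 2 and b^2 = z,
  \<open>M_{2^n}\<close> has L = 2^(n-2) and b^2 = e. Independence of the conjugates of \<alpha>_z
  suffices because every nontrivial normal form betrays itself through them: a nonzero power of x
  moves them, conjugates of \<alpha>_b produce them as commutators with conjugates of \<alpha>_a,
  and a product of powers of conjugates of \<alpha>_a turns into a product of them after raising it
  to a power of two. In the automaton, conjugation by x divides the series of exponents of z by 1 -
  t, so conjugation by negative powers yields polynomials of different degrees, and independence is
  visible in one letter. On the matrix side the obstacle is the rounding in \<lfloor>(m + n) /
  2\<rfloor>: the exponent is not m/2 + n/2 but depends on parities, so scaling one row and one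
  column is not enough and x has to exchange two coordinates. Characteristic 2 provides the torsion:
  unipotent matrices have 2-power order.\<close>

text \<open>As simplification rules these turn sums in \<open>bit\<close> into \<open>xor\<close> and defeat ring normalisation.\<close>

declare add_bit_eq_xor [simp del] mult_bit_eq_and [simp del]

section \<open>Twisting coefficients\<close>

text \<open>\<open>pascal_sum n k\<close> is the coefficient of \<open>t\<^sup>k\<close> in \<open>(1 - t)\<^sup>-\<^sup>n\<close>. In letter \<open>k\<close> of the image of a word \<open>w\<close>
  under \<open>x\<^sup>n \<alpha>\<^sub>h x\<^sup>-\<^sup>n\<close>, it is the exponent of \<open>h\<close>, and \<open>twist n k i\<close> is the exponent mod 2 of \<open>[w\<^sub>i, h]\<close>.\<close>

fun pascal_sum :: "nat \<Rightarrow> nat \<Rightarrow> nat" where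
  "pascal_sum 0 k = (if k = 0 then 1 else 0)"
| "pascal_sum (Suc n) 0 = 1"
| "pascal_sum (Suc n) (Suc k) = pascal_sum (Suc n) k + pascal_sum n (Suc k)"

fun twist :: "nat \<Rightarrow> nat \<Rightarrow> nat \<Rightarrow> bit" where
  "twist 0 k i = 0"
| "twist (Suc n) 0 i = 0"
| "twist (Suc n) (Suc k) i = twist (Suc n) k i + twist n (Suc k) i + twist n (Suc k) (Suc i)
     + (if i = k then of_nat (pascal_sum n (Suc k)) else 0)"


lemma bit_add_self [simp]: "(b::bit) + b = 0"
  by (cases b) (auto simp: add_bit_eq_xor)

lemma bit_add_left_self [simp]: "(b::bit) + (b + c) = c"
  by (cases b; cases c) (auto simp: add_bit_eq_xor)

lemma twist_triangular: "k \<le> i \<Longrightarrow> twist n k i = 0"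
  by (induction n k i rule: twist.induct) auto

lemma pascal_sum_0 [simp]: "pascal_sum n 0 = 1"
  by (cases n) auto

lemma pascal_sum_1 [simp]: "pascal_sum n (Suc 0) = n"
  by (induction n) auto

text \<open>Away from the diagonal both sides obey the same translation-invariant recursion. At
  \<open>k = Suc i\<close> the left side vanishes by \<open>twist_triangular\<close> while
  \<open>twist n k i\<close> need not, and the \<open>pascal_sum\<close> terms compensate for
  it.\<close>

lemma twist_shift:
  "twist n (Suc k) (Suc (Suc i)) = twist n k i +
    (if k = Suc i then of_nat (pascal_sum n (Suc i) + pascal_sum n (Suc (Suc i))) else 0)"
proof (induction n k i rule: twist.induct)
  case (1 k i)
  then show ?case by simp
next
  case (2 n i)
  then show ?case by (simp add: twist_triangular)
next
  case (3 n k i)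
  show ?case
    using 3 by (auto simp: twist_triangular add_ac)
qed

lemma twist_1_0: "twist (Suc n) (Suc 0) 0 = twist n (Suc 0) 0 + of_nat n"
  by (simp add: twist_triangular)

text \<open>Adding the recursions of columns 0 and 1 cancels column 1 of level \<open>n\<close> and
  leaves its columns 0 and 2. By \<open>twist_shift\<close>, column 2 repeats column 0 one row
  earlier, which cancels the contribution of the induction hypothesis.\<close>

lemma twist_column_sum:
  "twist (Suc n) (Suc (Suc k)) 0 + twist (Suc n) (Suc (Suc k)) (Suc 0) = twist n (Suc (Suc k)) 0"
proof (induction k)
  case 0
  then show ?case
    using twist_shift[of n "Suc 0" 0] by (simp add: twist_triangular add_ac)
next
  case (Suc k)
  have *: "twist (Suc n) (Suc (Suc (Suc k))) 0 + twist (Suc n) (Suc (Suc (Suc k))) (Suc 0) =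
     (twist (Suc n) (Suc (Suc k)) 0 + twist (Suc n) (Suc (Suc k)) (Suc 0))
     + twist n (Suc (Suc (Suc k))) 0 + twist n (Suc (Suc (Suc k))) (Suc (Suc 0))"
    by (subst (1 2) twist.simps(3)) (simp add: add_ac)
  show ?case unfolding * Suc twist_shift by simp
qed

text \<open>The exponents of \<open>[g, h]\<close> in the letters of the commutator of \<open>\<alpha>\<^sub>g\<close> with \<open>x\<^sup>n \<alpha>\<^sub>h x\<^sup>-\<^sup>n\<close>. As power
  series in \<open>t\<close> they satisfy \<open>c\<^sub>n\<^sub>+\<^sub>2 = c\<^sub>n / (1 - t)\<close>, which is where \<open>\<lfloor>n / 2\<rfloor>\<close> comes from.\<close>

definition comm_coeff :: "nat \<Rightarrow> nat \<Rightarrow> bit" where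
  "comm_coeff n k = (if k = 0 then 1 else twist n k 0)"

lemma comm_coeff_step:
  "comm_coeff (Suc (Suc n)) (Suc k) = comm_coeff (Suc (Suc n)) k + comm_coeff n (Suc k)"
proof (cases k)
  case 0
  then show ?thesis by (simp add: comm_coeff_def twist_1_0 add_ac twist_triangular)
next
  case (Suc j)
  have *: "twist (Suc (Suc n)) (Suc (Suc j)) 0 = twist (Suc (Suc n)) (Suc j) 0 +
    (twist (Suc n) (Suc (Suc j)) 0 + twist (Suc n) (Suc (Suc j)) (Suc 0))"
    by (subst twist.simps(3)) (simp add: add_ac)
  show ?thesis unfolding Suc comm_coeff_def * twist_column_sum by simp
qed

lemma comm_coeff_small: "n \<le> 1 \<Longrightarrow> comm_coeff n k = (if k = 0 then 1 else 0)"
proof (cases n; cases k)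
  fix j m assume "n \<le> 1" "n = Suc m" "k = Suc j"
  moreover have "twist (Suc 0) j 0 = 0" for j by (induction j) auto
  ultimately show ?thesis by (simp add: comm_coeff_def)
qed (auto simp: comm_coeff_def)

section \<open>Cross-wired lamplighter relations\<close>

definition list_prod :: "('a, 'b) monoid_scheme \<Rightarrow> ('i \<Rightarrow> 'a) \<Rightarrow> 'i list \<Rightarrow> 'a" where
  "list_prod G f is = foldr (\<lambda>i y. f i \<otimes>\<^bsub>G\<^esub> y) is \<one>\<^bsub>G\<^esub>"

lemma list_prod_simps [simp]:
  "list_prod G f [] = \<one>\<^bsub>G\<^esub>"
  "list_prod G f (i # is) = f i \<otimes>\<^bsub>G\<^esub> list_prod G f is"
  by (simp_all add: list_prod_def)

lemma list_prod_cong: "(\<And>i. i \<in> set is \<Longrightarrow> f i = g i) \<Longrightarrow> list_prod G f is = list_prod G g is"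
  by (induction "is") auto

lemma list_prod_map: "list_prod G f (map g is) = list_prod G (\<lambda>i. f (g i)) is"
  by (induction "is") auto

lemma list_prod_hom:
  assumes "group G" "group H" "h \<in> hom G H" "\<And>i. f i \<in> carrier G"
  shows "h (list_prod G f is) = list_prod H (\<lambda>i. h (f i)) is"
    and "list_prod G f is \<in> carrier G"
proof -
  interpret group_hom G H h
    using assms by (simp add: group_hom_def group_hom_axioms_def)
  show *: "list_prod G f is \<in> carrier G" for "is"
    using assms by (induction "is") auto
  show "h (list_prod G f is) = list_prod H (\<lambda>i. h (f i)) is"
    using assms * by (induction "is") auto
qed

context group
begin

lemma eq_one_iff_div: "a \<in> carrier G \<Longrightarrow> b \<in> carrier G \<Longrightarrow> a \<otimes> inv b = \<one> \<longleftrightarrow> a = b"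
  using inv_solve_right[of "\<one>" a b] by auto

lemma list_prod_closed: "(\<And>i. f i \<in> carrier G) \<Longrightarrow> list_prod G f is \<in> carrier G"
  by (induction "is") auto

lemma list_prod_intertwine:
  assumes "\<And>i. f i \<in> carrier G" "\<And>i. g i \<in> carrier G" "y \<in> carrier G"
    and "\<And>i. y \<otimes> f i = g i \<otimes> y"
  shows "y \<otimes> list_prod G f is = list_prod G g is \<otimes> y"
proof (induction "is")
  case (Cons i "is")
  have "y \<otimes> (f i \<otimes> list_prod G f is) = g i \<otimes> (y \<otimes> list_prod G f is)"
    using assms list_prod_closed by (metis m_assoc)
  moreover have "list_prod G g is \<in> carrier G"
    by (rule list_prod_closed) (rule assms)
  ultimately show ?case
    using assms Cons by (simp add: m_assoc)
qed (use assms in auto)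

lemma list_prod_mult:
  assumes "\<And>i. f i \<in> carrier G" "\<And>i. g i \<in> carrier G" "\<And>i j. f i \<otimes> g j = g j \<otimes> f i"
  shows "list_prod G (\<lambda>i. f i \<otimes> g i) is = list_prod G f is \<otimes> list_prod G g is"
proof (induction "is")
  case (Cons i "is")
  have c: "list_prod G f is \<in> carrier G" "list_prod G g is \<in> carrier G"
    by (rule list_prod_closed, rule assms)+
  have "list_prod G f is \<otimes> g i = g i \<otimes> list_prod G f is"
    by (rule list_prod_intertwine[symmetric]) (use assms in auto)
  then have "g i \<otimes> (list_prod G f is \<otimes> list_prod G g is) =
      list_prod G f is \<otimes> (g i \<otimes> list_prod G g is)"
    using c assms by (metis m_assoc)
  then show ?case
    using assms(1,2) c Cons by (simp add: m_assoc)
qed auto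

lemma list_prod_remove1:
  assumes "\<And>i. f i \<in> carrier G" "\<And>i j. f i \<otimes> f j = f j \<otimes> f i" "i \<in> set is"
  shows "list_prod G f is = f i \<otimes> list_prod G f (remove1 i is)"
  using assms(3)
proof (induction "is")
  case (Cons j "is")
  show ?case
  proof (cases "i = j")
    case False
    then have "list_prod G f (j # is) = f j \<otimes> (f i \<otimes> list_prod G f (remove1 i is))"
      using Cons by simp
    also have "\<dots> = f i \<otimes> (f j \<otimes> list_prod G f (remove1 i is))"
      using assms(1,2) list_prod_closed by (metis m_assoc)
    finally show ?thesis using False by simp
  qed simp
qed simp

lemma list_prod_pow:
  assumes "\<And>i. f i \<in> carrier G" "\<And>i j. f i \<otimes> f j = f j \<otimes> f i"
  shows "list_prod G f is [^] (n::nat) = list_prod G (\<lambda>i. f i [^] n) is"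
proof (induction n)
  case 0
  then show ?case by (induction "is") auto
next
  case (Suc n)
  have "list_prod G (\<lambda>i. f i [^] n \<otimes> f i) is = list_prod G (\<lambda>i. f i [^] n) is \<otimes> list_prod G f is"
    by (rule list_prod_mult) (use assms in \<open>auto intro: group_commutes_pow\<close>)
  then show ?case using Suc by simp
qed

lemma list_prod_filter:
  assumes "\<And>i. f i \<in> carrier G" "\<And>i. i \<in> set is \<Longrightarrow> \<not> P i \<Longrightarrow> f i = \<one>"
  shows "list_prod G f is = list_prod G f (filter P is)"
  using assms(2)
proof (induction "is")
  case (Cons i "is")
  have "list_prod G f (filter P is) \<in> carrier G"
    by (rule list_prod_closed) (rule assms)
  then show ?case using Cons by auto
qed simp

lemma list_prod_one: "(\<And>i. i \<in> set is \<Longrightarrow> f i = \<one>) \<Longrightarrow> list_prod G f is = \<one>"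
  by (induction "is") auto

end

text \<open>\<open>A m\<close> and \<open>B m\<close> stand for the conjugates of \<alpha>_a and
  \<alpha>_b by x^m, \<open>L\<close> for the exponent with a^L = z. On integers \<open>div\<close>
  rounds down, also below zero, as the commutator relation demands. The locale is instantiated by
  the automaton, by the matrices and by the product of the two groups.\<close>

locale lamp_relations = group K for K (structure) +
  fixes x and A B :: "int \<Rightarrow> 'a" and L :: nat and \<epsilon> :: bool
  assumes x_closed [simp, intro]: "x \<in> carrier K"
    and A_closed [simp, intro]: "A m \<in> carrier K"
    and B_closed [simp, intro]: "B m \<in> carrier K"
    and x_A: "x \<otimes> A m = A (m + 1) \<otimes> x"
    and x_B: "x \<otimes> B m = B (m + 1) \<otimes> x"
    and A_A: "A m \<otimes> A n = A n \<otimes> A m"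
    and B_B: "B m \<otimes> B n = B n \<otimes> B m"
    and B_A: "B m \<otimes> A n = A ((m + n) div 2) [^] L \<otimes> A n \<otimes> B m"
    and A_pow: "A m [^] (2 * L) = \<one>"
    and B_sq: "B m \<otimes> B m = (if \<epsilon> then A m [^] L else \<one>)"
    and even_L: "even L"
    and pos_L: "0 < L"
begin

definition Z :: "int \<Rightarrow> 'a" where "Z m = A m [^] L"

lemma Z_closed [simp, intro]: "Z m \<in> carrier K"
  by (simp add: Z_def)

lemma Z_sq: "Z m \<otimes> Z m = \<one>"
  using A_pow[of m] by (simp add: Z_def nat_pow_mult mult_2)

lemma Z_pow: "Z m [^] (n::nat) = (if even n then \<one> else Z m)"
  by (induction n) (auto simp: Z_sq)

lemma A_pow_A: "A m [^] (i::nat) \<otimes> A n = A n \<otimes> A m [^] i"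
  by (rule group_commutes_pow) (auto simp: A_A)

lemma A_pow_A_pow: "A m [^] (i::nat) \<otimes> A n [^] (j::nat) = A n [^] j \<otimes> A m [^] i"
  by (rule group_commutes_pow, rule group_commutes_pow[symmetric]) (auto simp: A_A)

lemma Z_Z: "Z m \<otimes> Z n = Z n \<otimes> Z m"
  unfolding Z_def by (rule A_pow_A_pow)

lemma B_A_pow: "B m \<otimes> A n [^] (i::nat) = Z ((m + n) div 2) [^] i \<otimes> A n [^] i \<otimes> B m"
proof (induction i)
  case (Suc i)
  let ?z = "Z ((m + n) div 2)"
  have "B m \<otimes> A n [^] Suc i = (B m \<otimes> A n [^] i) \<otimes> A n"
    by (simp add: m_assoc)
  also have "\<dots> = ?z [^] i \<otimes> A n [^] i \<otimes> (B m \<otimes> A n)"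
    unfolding Suc by (simp add: m_assoc)
  also have "\<dots> = ?z [^] i \<otimes> (A n [^] i \<otimes> ?z) \<otimes> A n \<otimes> B m"
    unfolding B_A Z_def by (simp add: m_assoc)
  also have "A n [^] i \<otimes> ?z = ?z \<otimes> A n [^] i"
    unfolding Z_def by (rule A_pow_A_pow)
  finally show ?case by (simp add: m_assoc)
qed simp

lemma B_Z: "B m \<otimes> Z n = Z n \<otimes> B m"
  using B_A_pow[of m n L] even_L by (simp add: Z_pow flip: Z_def)

section \<open>Existence of normal forms\<close>

definition A_forms :: "'a set" where
  "A_forms = {list_prod K (\<lambda>m. A m [^] i m) ms | (i :: int \<Rightarrow> nat) ms. distinct ms}"

lemma A_form_closed: "list_prod K (\<lambda>m. A m [^] (i m :: nat)) ms \<in> carrier K"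
  by (rule list_prod_closed) auto

lemma A_forms_carrier: "y \<in> A_forms \<Longrightarrow> y \<in> carrier K"
  using A_form_closed by (auto simp: A_forms_def)

lemma one_A_forms: "\<one> \<in> A_forms"
  unfolding A_forms_def by (rule CollectI, rule exI, rule exI[of _ "[]"]) simp

lemma A_pow_forms:
  assumes "y \<in> A_forms"
  shows "A n [^] (j::nat) \<otimes> y \<in> A_forms"
proof -
  obtain i ms where d: "distinct ms" and y: "y = list_prod K (\<lambda>m. A m [^] (i m :: nat)) ms"
    using assms by (auto simp: A_forms_def)
  define ns where "ns = remove1 n ms"
  define i' where "i' = i(n := if n \<in> set ms then j + i n else j)"
  have ns: "n \<notin> set ns" "distinct ns" using d by (auto simp: ns_def)
  have eq: "list_prod K (\<lambda>m. A m [^] (i m :: nat)) ns = list_prod K (\<lambda>m. A m [^] i' m) ns"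
    by (rule list_prod_cong) (use ns in \<open>auto simp: i'_def\<close>)
  have "A n [^] j \<otimes> y = A n [^] i' n \<otimes> list_prod K (\<lambda>m. A m [^] i' m) ns"
  proof (cases "n \<in> set ms")
    case True
    then have "y = A n [^] i n \<otimes> list_prod K (\<lambda>m. A m [^] i m) ns"
      unfolding y ns_def by (intro list_prod_remove1) (auto simp: A_pow_A_pow)
    then show ?thesis
      using True A_form_closed by (simp add: eq i'_def nat_pow_mult flip: m_assoc)
  next
    case False
    then have "ns = ms" by (simp add: ns_def remove1_idem)
    moreover have "i' n = j" using False by (simp add: i'_def)
    ultimately show ?thesis using eq y by simp
  qed
  also have "\<dots> = list_prod K (\<lambda>m. A m [^] i' m) (n # ns)" by simp
  finally show ?thesis
    unfolding A_forms_def using ns by (metis (mono_tags, lifting) CollectI distinct.simps(2))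
qed

lemma A_forms_mult:
  assumes "y \<in> A_forms" "y' \<in> A_forms"
  shows "y \<otimes> y' \<in> A_forms"
proof -
  have "list_prod K (\<lambda>m. A m [^] (i m :: nat)) ms \<otimes> y' \<in> A_forms" for i ms
  proof (induction ms)
    case Nil
    then show ?case using assms A_forms_carrier by simp
  next
    case (Cons m ms)
    then show ?case using A_pow_forms A_form_closed A_forms_carrier[OF assms(2)]
      by (simp add: m_assoc)
  qed
  then show ?thesis using assms by (auto simp: A_forms_def)
qed

lemma A_pow_in_forms: "A n [^] (j::nat) \<in> A_forms"
  using A_pow_forms[OF one_A_forms, of n j] by simp

lemma Z_in_forms: "Z n \<in> A_forms"
  by (simp add: Z_def A_pow_in_forms)

lemma B_A_forms:
  assumes "y \<in> A_forms"
  shows "\<exists>y' \<in> A_forms. B n \<otimes> y = y' \<otimes> B n"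
proof -
  have "\<exists>y' \<in> A_forms. B n \<otimes> list_prod K (\<lambda>m. A m [^] (i m :: nat)) ms = y' \<otimes> B n" for i ms
  proof (induction ms)
    case Nil
    then show ?case using one_A_forms by (intro bexI[of _ "\<one>"]) auto
  next
    case (Cons m ms)
    then obtain y' where y': "y' \<in> A_forms"
      "B n \<otimes> list_prod K (\<lambda>m. A m [^] (i m :: nat)) ms = y' \<otimes> B n" by auto
    let ?u = "Z ((n + m) div 2) [^] i m" and ?v = "A m [^] i m"
    let ?r = "list_prod K (\<lambda>m. A m [^] (i m :: nat)) ms"
    have r: "?r \<in> carrier K" by (rule A_form_closed)
    have "B n \<otimes> (?v \<otimes> ?r) = ?u \<otimes> ?v \<otimes> (B n \<otimes> ?r)"
      using B_A_pow[of n m "i m"] r by (simp flip: m_assoc)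
    also have "\<dots> = (?u \<otimes> (?v \<otimes> y')) \<otimes> B n"
      unfolding y'(2) using y'(1) A_forms_carrier by (simp add: m_assoc)
    finally have "B n \<otimes> list_prod K (\<lambda>m. A m [^] (i m :: nat)) (m # ms) = (?u \<otimes> (?v \<otimes> y')) \<otimes> B n"
      by simp
    moreover have "?u \<in> A_forms"
      by (simp add: Z_pow one_A_forms Z_in_forms)
    then have "?u \<otimes> (?v \<otimes> y') \<in> A_forms"
      using A_pow_forms y' A_forms_mult by blast
    ultimately show ?case by blast
  qed
  then show ?thesis using assms by (auto simp: A_forms_def)
qed

text \<open>Stated for general \<open>u\<close> and \<open>\<delta>\<close> so as to cover both
  \<open>x\<close> with shift 1 and its inverse with shift -1.\<close>

lemma shift_A_forms:
  assumes "y \<in> A_forms" "u \<in> carrier K" "\<And>m. u \<otimes> A m = A (m + \<delta>) \<otimes> u"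
  shows "\<exists>y' \<in> A_forms. u \<otimes> y = y' \<otimes> u"
proof -
  obtain i ms where d: "distinct ms" and y: "y = list_prod K (\<lambda>m. A m [^] (i m :: nat)) ms"
    using assms by (auto simp: A_forms_def)
  have pw: "u \<otimes> A m [^] (j::nat) = A (m + \<delta>) [^] j \<otimes> u" for m j
  proof (induction j)
    case (Suc j)
    have "u \<otimes> A m [^] Suc j = (u \<otimes> A m [^] j) \<otimes> A m" using assms by (simp add: m_assoc)
    also have "\<dots> = A (m + \<delta>) [^] j \<otimes> (u \<otimes> A m)" unfolding Suc using assms by (simp add: m_assoc)
    also have "\<dots> = A (m + \<delta>) [^] Suc j \<otimes> u" using assms by (simp add: m_assoc)
    finally show ?case .
  qed (use assms in simp)
  have "u \<otimes> y = list_prod K (\<lambda>m. A (m + \<delta>) [^] i m) ms \<otimes> u"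
    unfolding y by (rule list_prod_intertwine) (auto simp: assms pw)
  also have "list_prod K (\<lambda>m. A (m + \<delta>) [^] i m) ms =
     list_prod K (\<lambda>m. A m [^] i (m - \<delta>)) (map (\<lambda>m. m + \<delta>) ms)"
    by (simp add: list_prod_map)
  moreover have "list_prod K (\<lambda>m. A m [^] i (m - \<delta>)) (map (\<lambda>m. m + \<delta>) ms) \<in> A_forms"
    unfolding A_forms_def using d
    by (intro CollectI exI[of _ "\<lambda>m. i (m - \<delta>)"] exI[of _ "map (\<lambda>m. m + \<delta>) ms"])
      (auto simp: distinct_map inj_on_def)
  ultimately show ?thesis by auto
qed

text \<open>The indices in \<open>ns\<close> are distinct because a square of some
  \<open>B n\<close> is moved into the \<open>A\<close> part. The involutions \<open>Z m\<close>
  arising from commutators are powers of \<open>A m\<close>, so they go there as well.\<close>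

definition normal_forms :: "'a set" where
  "normal_forms = {y \<otimes> (list_prod K B ns \<otimes> x [^] (k::int)) | y ns k. y \<in> A_forms \<and> distinct ns}"

lemma B_prod_closed [simp, intro]: "list_prod K B ns \<in> carrier K"
  by (rule list_prod_closed) auto

lemma normal_formI: "y \<in> A_forms \<Longrightarrow> distinct ns \<Longrightarrow> y \<otimes> (list_prod K B ns \<otimes> x [^] (k::int)) \<in> normal_forms"
  by (auto simp: normal_forms_def)

lemma normal_forms_carrier: "q \<in> normal_forms \<Longrightarrow> q \<in> carrier K"
  by (auto simp: normal_forms_def A_forms_carrier)

lemma A_forms_normal:
  assumes "y \<in> A_forms" "q \<in> normal_forms"
  shows "y \<otimes> q \<in> normal_forms"
proof -
  obtain y' ns k where q: "y' \<in> A_forms" "distinct ns" "q = y' \<otimes> (list_prod K B ns \<otimes> x [^] (k::int))"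
    using assms by (auto simp: normal_forms_def)
  have "y \<otimes> q = (y \<otimes> y') \<otimes> (list_prod K B ns \<otimes> x [^] k)"
    using q assms A_forms_carrier by (simp add: m_assoc)
  then show ?thesis using normal_formI A_forms_mult q assms by metis
qed

lemma B_normal:
  assumes "q \<in> normal_forms"
  shows "B n \<otimes> q \<in> normal_forms"
proof -
  obtain y ns k where q: "y \<in> A_forms" "distinct ns" "q = y \<otimes> (list_prod K B ns \<otimes> x [^] (k::int))"
    using assms by (auto simp: normal_forms_def)
  obtain y' where y': "y' \<in> A_forms" "B n \<otimes> y = y' \<otimes> B n"
    using B_A_forms q by blast
  have "B n \<otimes> q = (B n \<otimes> y) \<otimes> (list_prod K B ns \<otimes> x [^] k)"
    using q(3) A_forms_carrier[OF q(1)] by (simp add: m_assoc)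
  also have "\<dots> = y' \<otimes> (B n \<otimes> (list_prod K B ns \<otimes> x [^] k))"
    unfolding y'(2) using A_forms_carrier[OF y'(1)] by (simp add: m_assoc)
  finally have eq: "B n \<otimes> q = y' \<otimes> (B n \<otimes> (list_prod K B ns \<otimes> x [^] k))" .
  have "B n \<otimes> (list_prod K B ns \<otimes> x [^] k) \<in> normal_forms"
  proof (cases "n \<in> set ns")
    case False
    then have "\<one> \<otimes> (list_prod K B (n # ns) \<otimes> x [^] k) \<in> normal_forms"
      using q by (intro normal_formI one_A_forms) auto
    then show ?thesis by (simp add: m_assoc)
  next
    \<comment> \<open>The square of \<open>B n\<close> is \<open>\<one>\<close> or
      \<open>Z n\<close>, hence an element of \<open>A_forms\<close>.\<close>
    case True
    then have "list_prod K B ns = B n \<otimes> list_prod K B (remove1 n ns)"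
      by (intro list_prod_remove1) (auto simp: B_B)
    then have "B n \<otimes> (list_prod K B ns \<otimes> x [^] k) =
        (B n \<otimes> B n) \<otimes> (list_prod K B (remove1 n ns) \<otimes> x [^] k)"
      by (simp add: m_assoc)
    moreover have "B n \<otimes> B n \<in> A_forms"
      unfolding B_sq using Z_in_forms one_A_forms by (simp add: Z_def)
    ultimately show ?thesis using normal_formI q(2) by simp
  qed
  then show ?thesis using eq A_forms_normal y' by simp
qed

lemma shift_normal:
  assumes "q \<in> normal_forms" "u = x [^] (d::int)"
    and A: "\<And>m. u \<otimes> A m = A (m + \<delta>) \<otimes> u" and B: "\<And>m. u \<otimes> B m = B (m + \<delta>) \<otimes> u"
  shows "u \<otimes> q \<in> normal_forms"
proof -
  have u: "u \<in> carrier K" using assms by simp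
  obtain y ns k where q: "y \<in> A_forms" "distinct ns" "q = y \<otimes> (list_prod K B ns \<otimes> x [^] (k::int))"
    using assms by (auto simp: normal_forms_def)
  obtain y' where y': "y' \<in> A_forms" "u \<otimes> y = y' \<otimes> u"
    using shift_A_forms[OF q(1) u] A by blast
  have b: "u \<otimes> list_prod K B ns = list_prod K B (map (\<lambda>m. m + \<delta>) ns) \<otimes> u"
    unfolding list_prod_map by (rule list_prod_intertwine) (auto simp: u B)
  have "u \<otimes> q = (u \<otimes> y) \<otimes> (list_prod K B ns \<otimes> x [^] k)"
    using q(3) u A_forms_carrier[OF q(1)] by (simp add: m_assoc)
  also have "\<dots> = y' \<otimes> ((u \<otimes> list_prod K B ns) \<otimes> x [^] k)"
    unfolding y'(2) using u A_forms_carrier[OF y'(1)] by (simp add: m_assoc)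
  also have "\<dots> = y' \<otimes> (list_prod K B (map (\<lambda>m. m + \<delta>) ns) \<otimes> x [^] (d + k))"
    unfolding b using u by (simp add: m_assoc assms(2) int_pow_mult)
  finally show ?thesis
    using normal_formI[OF y'(1), of "map (\<lambda>m. m + \<delta>) ns"] q(2) by (simp add: distinct_map inj_on_def)
qed

lemma inv_x_intertwine:
  assumes "g \<in> carrier K" "h \<in> carrier K" "x \<otimes> g = h \<otimes> x"
  shows "inv x \<otimes> h = g \<otimes> inv x"
  using assms by (metis inv_closed inv_solve_left inv_solve_right m_assoc m_closed x_closed)

text \<open>Left multiplication by each generator and by its inverse preserves normal forms, and
  \<open>\<one>\<close> is one. The induction therefore treats \<open>p \<otimes> q\<close> for all
  normal forms \<open>q\<close> at once.\<close>

lemma generate_normal_forms: "generate K {x, A 0, B 0} \<subseteq> normal_forms"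
proof -
  have x: "x \<otimes> q \<in> normal_forms" if "q \<in> normal_forms" for q
    using shift_normal[OF that, of x 1 1] by (simp add: x_A x_B int_pow_1)
  have ix: "inv x \<otimes> q \<in> normal_forms" if q: "q \<in> normal_forms" for q
  proof (rule shift_normal[OF q])
    show "inv x = x [^] (-1::int)" by (simp add: int_pow_neg int_pow_1)
    show "inv x \<otimes> A m = A (m + - 1) \<otimes> inv x" for m
      using inv_x_intertwine[OF _ _ x_A[of "m - 1"]] by simp
    show "inv x \<otimes> B m = B (m + - 1) \<otimes> inv x" for m
      using inv_x_intertwine[OF _ _ x_B[of "m - 1"]] by simp
  qed
  \<comment> \<open>Exponents in \<open>A_forms\<close> are natural numbers, so inverses have to be
    written as positive powers.\<close>
  have "A 0 [^] (2 * L - 1) \<otimes> A 0 = A 0 [^] (2 * L)"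
    using pos_L by (metis One_nat_def Suc_pred mult_pos_pos nat_pow_Suc pos2)
  then have invA: "inv (A 0) = A 0 [^] (2 * L - 1)"
    using A_pow by (intro inv_equality) auto
  have "(B 0 \<otimes> B 0) \<otimes> (B 0 \<otimes> B 0) = \<one>"
    unfolding B_sq using Z_sq by (simp add: Z_def)
  then have invB: "inv (B 0) = B 0 \<otimes> (B 0 \<otimes> B 0)"
    by (intro inv_equality) (auto simp: m_assoc)
  have "\<forall>q \<in> normal_forms. p \<otimes> q \<in> normal_forms" if "p \<in> generate K {x, A 0, B 0}" for p
    using that
  proof (induction rule: generate.induct)
    case one
    then show ?case using normal_forms_carrier by simp
  next
    case (incl h)
    then show ?case using x A_forms_normal[OF A_pow_in_forms[of 0 1]] B_normal by auto
  next
    case (inv h)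
    then show ?case
      using ix A_forms_normal[OF A_pow_in_forms[of 0 "2 * L - 1"]] B_normal normal_forms_carrier
      by (auto simp: invA invB m_assoc)
  next
    case (eng h1 h2)
    have "h1 \<in> carrier K" "h2 \<in> carrier K"
      using eng generate_in_carrier[of "{x, A 0, B 0}"] by auto
    then show ?case using eng normal_forms_carrier by (simp add: m_assoc)
  qed
  moreover have "\<one> \<otimes> (list_prod K B [] \<otimes> x [^] (0::int)) \<in> normal_forms"
    by (intro normal_formI one_A_forms) simp
  then have "\<one> \<in> normal_forms" by simp
  ultimately show ?thesis
    using generate_in_carrier[of "{x, A 0, B 0}"] by (metis insert_subset empty_subsetI A_closed B_closed x_closed r_one subsetI)
qed

end

text \<open>The assumption says that the involutions \<open>A m [^] L\<close> are independent; it is stated for products with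
  a leading factor of strictly smallest index because repetitions among the others occur below.\<close>

locale faithful_lamp = lamp_relations +
  assumes leading_term: "(\<And>r. r \<in> set qs \<Longrightarrow> q < r) \<Longrightarrow> list_prod K (\<lambda>m. A m [^] L) (q # qs) \<noteq> \<one>"
begin

section \<open>Uniqueness of normal forms\<close>

lemma Z_leading: "(\<And>r. r \<in> set qs \<Longrightarrow> q < r) \<Longrightarrow> Z q \<otimes> list_prod K Z qs \<noteq> \<one>"
  using leading_term[of qs q] by (simp add: Z_def[abs_def])

lemma x_pow_Z: "x [^] (k::int) \<otimes> Z m = Z (m + k) \<otimes> x [^] k"
proof -
  have A1: "x [^] n \<otimes> A m = A (m + int n) \<otimes> x [^] n" for n :: nat and m
  proof (induction n arbitrary: m)
    case (Suc n)
    have "x [^] Suc n \<otimes> A m = x [^] n \<otimes> (x \<otimes> A m)" by (simp add: m_assoc)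
    also have "\<dots> = x [^] n \<otimes> A (m + 1) \<otimes> x" by (simp add: x_A m_assoc)
    also have "\<dots> = A (m + 1 + int n) \<otimes> x [^] Suc n" unfolding Suc by (simp add: m_assoc)
    finally show ?case by (simp add: add_ac)
  qed simp
  have Z1: "x [^] n \<otimes> Z m = Z (m + int n) \<otimes> x [^] n" for n :: nat and m
  proof -
    have "x [^] n \<otimes> A m [^] j = A (m + int n) [^] j \<otimes> x [^] n" for j :: nat
    proof (induction j)
      case (Suc j)
      have "x [^] n \<otimes> A m [^] Suc j = (x [^] n \<otimes> A m [^] j) \<otimes> A m" by (simp add: m_assoc)
      also have "\<dots> = A (m + int n) [^] j \<otimes> (x [^] n \<otimes> A m)" unfolding Suc by (simp add: m_assoc)
      also have "\<dots> = A (m + int n) [^] Suc j \<otimes> x [^] n" by (simp add: A1 m_assoc)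
      finally show ?case .
    qed simp
    then show ?thesis by (simp add: Z_def)
  qed
  show ?thesis
  proof (cases "k \<ge> 0")
    case True
    then show ?thesis using Z1[of "nat k" m] by (metis int_nat_eq int_pow_int)
  next
    case False
    define n where "n = nat (- k)"
    have k: "k = - int n" using False by (simp add: n_def)
    have "inv (x [^] n) \<otimes> Z m = Z (m + k) \<otimes> inv (x [^] n)"
      using Z1[of n "m + k"] unfolding k
      by simp (metis Z_closed inv_closed inv_solve_left inv_solve_right m_assoc m_closed nat_pow_closed x_closed)
    then show ?thesis unfolding k by (simp add: int_pow_neg int_pow_int)
  qed
qed

lemma A_form_Z: "list_prod K (\<lambda>m. A m [^] (i m :: nat)) ms \<otimes> Z n = Z n \<otimes> list_prod K (\<lambda>m. A m [^] i m) ms"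
  by (rule list_prod_intertwine[symmetric]) (auto simp: Z_def A_pow_A_pow)

text \<open>Divisibility of the exponents by \<open>2 ^ j\<close> is raised one power at a time: a
  suitable power of the product is a product of involutions \<open>Z m\<close>, one for each
  quotient that is still odd, and independence rules these out.\<close>

lemma A_form_trivial:
  assumes "distinct ms" "list_prod K (\<lambda>m. A m [^] (i m :: nat)) ms = \<one>" "L = 2 ^ l" "m \<in> set ms"
  shows "2 * L dvd i m"
proof -
  have "j \<le> Suc l \<Longrightarrow> \<forall>m \<in> set ms. 2 ^ j dvd i m" for j
  proof (induction j)
    case (Suc j)
    then have j: "j \<le> l" and IH: "\<forall>m \<in> set ms. 2 ^ j dvd i m" by auto
    define i' where "i' m = i m div 2 ^ j" for m
    have i': "i m = 2 ^ j * i' m" if "m \<in> set ms" for m using IH that by (simp add: i'_def)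
    \<comment> \<open>The power \<open>2 ^ (l - j)\<close> completes the known factor
      \<open>2 ^ j\<close> of each exponent to \<open>L\<close>.\<close>
    have "\<one> = list_prod K (\<lambda>m. A m [^] i m) ms [^] ((2::nat) ^ (l - j))" by (simp add: assms)
    also have "\<dots> = list_prod K (\<lambda>m. (A m [^] i m) [^] ((2::nat) ^ (l - j))) ms"
      by (rule list_prod_pow) (auto simp: A_pow_A_pow)
    also have "\<dots> = list_prod K (\<lambda>m. Z m [^] i' m) ms"
    proof (rule list_prod_cong)
      fix m assume m: "m \<in> set ms"
      have "i m * 2 ^ (l - j) = L * i' m"
        using j by (simp add: i'[OF m] assms(3) mult_ac flip: power_add)
      then show "(A m [^] i m) [^] ((2::nat) ^ (l - j)) = Z m [^] i' m"
        by (simp add: Z_def nat_pow_pow)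
    qed
    also have "\<dots> = list_prod K (\<lambda>m. Z m [^] i' m) (filter (\<lambda>m. odd (i' m)) ms)"
      by (rule list_prod_filter) (auto simp: Z_pow)
    also have "\<dots> = list_prod K Z (filter (\<lambda>m. odd (i' m)) ms)"
      by (rule list_prod_cong) (auto simp: Z_pow)
    finally have one: "list_prod K Z (filter (\<lambda>m. odd (i' m)) ms) = \<one>" by simp
    have "filter (\<lambda>m. odd (i' m)) ms = []"
    proof (rule ccontr)
      let ?os = "filter (\<lambda>m. odd (i' m)) ms"
      assume ne: "?os \<noteq> []"
      define q where "q = Min (set ?os)"
      have q: "q \<in> set ?os" using ne unfolding q_def by (intro Min_in) (simp_all only: set_empty finite_set not_False_eq_True)
      have "list_prod K Z ?os = Z q \<otimes> list_prod K Z (remove1 q ?os)"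
        by (rule list_prod_remove1) (use q Z_Z in auto)
      moreover have "q < r" if "r \<in> set (remove1 q ?os)" for r
      proof -
        have "r \<in> set ?os" "r \<noteq> q"
          using that assms(1) by (auto simp: set_remove1_eq)
        then show ?thesis using Min_le[of "set ?os" r] unfolding q_def[symmetric] by auto
      qed
      ultimately show False using Z_leading one by metis
    qed
    then have "\<forall>m \<in> set ms. even (i' m)" by (auto simp: filter_empty_conv)
    then show ?case using i' by (auto simp: mult_dvd_mono mult.commute)
  qed simp
  from this[of "Suc l"] show ?thesis using assms by simp
qed

text \<open>Moving \<open>A n\<close> through the product costs one factor
  \<open>Z ((m + n) div 2)\<close> for each \<open>m\<close> in \<open>ns\<close>. If everything
  commutes, the product of these factors is trivial, against independence.\<close>

lemma B_prod_noncentral: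
  assumes "distinct ns" "\<And>n. list_prod K B ns \<otimes> A n = A n \<otimes> list_prod K B ns"
  shows "ns = []"
proof (rule ccontr)
  assume "ns \<noteq> []"
  define q where "q = Min (set ns)"
  have q: "q \<in> set ns" using \<open>ns \<noteq> []\<close> unfolding q_def by (intro Min_in) auto
  \<comment> \<open>Halving may identify neighbouring indices. This \<open>n\<close> makes
    \<open>q + n\<close> odd, so \<open>(q + n) div 2 = 0\<close> lies strictly below the value for
    every \<open>m > q\<close>; larger indices may still collide with each other.\<close>
  define n where "n = 1 - q"
  have "list_prod K B ms \<otimes> A n = list_prod K (\<lambda>m. Z ((m + n) div 2)) ms \<otimes> (A n \<otimes> list_prod K B ms)" for ms
  proof (induction ms)
    case (Cons m ms)
    let ?z = "list_prod K (\<lambda>m. Z ((m + n) div 2)) ms"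
    have c: "?z \<in> carrier K" by (rule list_prod_closed) auto
    have Bz: "B m \<otimes> ?z = ?z \<otimes> B m"
      by (rule list_prod_intertwine) (auto simp: B_Z)
    have zZ: "?z \<otimes> Z ((m + n) div 2) = Z ((m + n) div 2) \<otimes> ?z"
      by (rule list_prod_intertwine[symmetric]) (auto simp: Z_Z)
    have BA: "B m \<otimes> A n = Z ((m + n) div 2) \<otimes> (A n \<otimes> B m)"
      using B_A[of m n] by (simp add: m_assoc flip: Z_def)
    have "list_prod K B (m # ms) \<otimes> A n = (B m \<otimes> ?z) \<otimes> (A n \<otimes> list_prod K B ms)"
      using c by (simp add: m_assoc Cons)
    also have "\<dots> = ?z \<otimes> (B m \<otimes> A n) \<otimes> list_prod K B ms"
      unfolding Bz using c by (simp add: m_assoc)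
    also have "\<dots> = ?z \<otimes> (Z ((m + n) div 2) \<otimes> (A n \<otimes> B m)) \<otimes> list_prod K B ms"
      by (simp only: BA)
    also have "\<dots> = (?z \<otimes> Z ((m + n) div 2)) \<otimes> (A n \<otimes> (B m \<otimes> list_prod K B ms))"
      using c by (simp add: m_assoc)
    finally show ?case
      unfolding zZ using c by (simp add: m_assoc)
  qed simp
  from this[of ns] have "A n \<otimes> list_prod K B ns = list_prod K (\<lambda>m. Z ((m + n) div 2)) ns \<otimes> (A n \<otimes> list_prod K B ns)"
    using assms(2) by simp
  moreover have c: "list_prod K (\<lambda>m. Z ((m + n) div 2)) ns \<in> carrier K"
    by (rule list_prod_closed) auto
  ultimately have "list_prod K (\<lambda>m. Z ((m + n) div 2)) ns = \<one>"
    by (metis A_closed B_prod_closed m_closed r_cancel_one')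
  also have "list_prod K (\<lambda>m. Z ((m + n) div 2)) ns =
      Z ((q + n) div 2) \<otimes> list_prod K (\<lambda>m. Z ((m + n) div 2)) (remove1 q ns)"
    by (rule list_prod_remove1) (use q Z_Z in auto)
  also have "\<dots> = Z ((q + n) div 2) \<otimes> list_prod K Z (map (\<lambda>m. (m + n) div 2) (remove1 q ns))"
    by (simp add: list_prod_map)
  finally have "Z ((q + n) div 2) \<otimes> list_prod K Z (map (\<lambda>m. (m + n) div 2) (remove1 q ns)) = \<one>" .
  moreover have "(q + n) div 2 < r" if r: "r \<in> set (map (\<lambda>m. (m + n) div 2) (remove1 q ns))" for r
  proof -
    obtain m where m: "m \<in> set ns" "m \<noteq> q" "r = (m + n) div 2"
      using r assms(1) by (auto simp: set_remove1_eq)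
    then have "q \<le> m" unfolding q_def by auto
    then show ?thesis using m by (simp add: n_def)
  qed
  ultimately show False using Z_leading by metis
qed

text \<open>If \<open>k \<noteq> 0\<close>, commuting \<open>Z 0\<close> past the trivial element
  would give \<open>Z 0 = Z k\<close>. With \<open>k = 0\<close> the \<open>B\<close> part is
  inverse to the \<open>A\<close> part and so commutes with every \<open>A n\<close>;
  \<open>B_prod_noncentral\<close> empties it, and \<open>A_form_trivial\<close> treats the
  rest.\<close>

lemma normal_form_trivial:
  assumes "distinct ms" "distinct ns" "L = 2 ^ l"
    and one: "list_prod K (\<lambda>m. A m [^] (i m :: nat)) ms \<otimes> (list_prod K B ns \<otimes> x [^] (k::int)) = \<one>"
  shows "k = 0 \<and> ns = [] \<and> (\<forall>m \<in> set ms. 2 * L dvd i m)"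
proof -
  let ?a = "list_prod K (\<lambda>m. A m [^] (i m :: nat)) ms" and ?b = "list_prod K B ns"
  have a: "?a \<in> carrier K" by (rule A_form_closed)
  have k: "k = 0"
  proof (rule ccontr)
    assume "k \<noteq> 0"
    have bz: "?b \<otimes> Z k = Z k \<otimes> ?b"
      by (rule list_prod_intertwine[symmetric]) (auto simp: B_Z)
    have "Z 0 = (?a \<otimes> (?b \<otimes> x [^] k)) \<otimes> Z 0" by (simp add: one)
    also have "\<dots> = ?a \<otimes> (?b \<otimes> (x [^] k \<otimes> Z 0))" using a by (simp add: m_assoc)
    also have "\<dots> = ?a \<otimes> ((?b \<otimes> Z k) \<otimes> x [^] k)" unfolding x_pow_Z using a by (simp add: m_assoc)
    also have "\<dots> = (?a \<otimes> Z k) \<otimes> (?b \<otimes> x [^] k)" unfolding bz using a by (simp add: m_assoc)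
    also have "\<dots> = Z k \<otimes> (?a \<otimes> (?b \<otimes> x [^] k))" unfolding A_form_Z using a by (simp add: m_assoc)
    finally have "Z 0 = Z k" using one by simp
    then have "Z (min 0 k) \<otimes> list_prod K Z [max 0 k] = \<one>"
      using Z_sq by (auto simp: min_def max_def)
    moreover have "min 0 k < r" if "r \<in> set [max 0 k]" for r
      using that \<open>k \<noteq> 0\<close> by auto
    ultimately show False using Z_leading by metis
  qed
  then have ab: "?a \<otimes> ?b = \<one>" using one by simp
  have ns: "ns = []"
  proof (rule B_prod_noncentral[OF assms(2)])
    fix n
    have an: "?a \<otimes> A n = A n \<otimes> ?a"
      by (rule list_prod_intertwine[symmetric]) (auto simp: A_pow_A[symmetric])
    have "?a \<otimes> (?b \<otimes> A n) = A n \<otimes> (?a \<otimes> ?b)"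
      using a by (simp add: ab flip: m_assoc)
    also have "\<dots> = ?a \<otimes> (A n \<otimes> ?b)" using a an by (simp flip: m_assoc)
    finally show "?b \<otimes> A n = A n \<otimes> ?b" using a by simp
  qed
  then show ?thesis using k ab a A_form_trivial[OF assms(1) _ assms(3)] by simp
qed

end

lemma (in lamp_relations) trivial_normal_form:
  assumes "k = 0 \<and> ns = [] \<and> (\<forall>m \<in> set ms. 2 * L dvd i m)"
  shows "list_prod K (\<lambda>m. A m [^] (i m :: nat)) ms \<otimes> (list_prod K B ns \<otimes> x [^] (k::int)) = \<one>"
proof -
  have "list_prod K (\<lambda>m. A m [^] i m) ms = \<one>"
  proof (rule list_prod_one)
    fix m assume "m \<in> set ms"
    then obtain j where "i m = 2 * L * j" using assms by (auto elim: dvdE)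
    then show "A m [^] i m = \<one>" using A_pow[of m] by (simp flip: nat_pow_pow)
  qed
  then show ?thesis using assms by simp
qed

text \<open>The right-hand side speaks of exponents and indices alone, so the same normal form is
  trivial in all groups of this kind or in none.\<close>

lemma faithful_lamp_normal_form_iff:
  assumes "faithful_lamp H x A B L \<epsilon>" "L = 2 ^ l" "distinct ms" "distinct ns"
  shows "list_prod H (\<lambda>m. A m [^]\<^bsub>H\<^esub> (i m :: nat)) ms \<otimes>\<^bsub>H\<^esub> (list_prod H B ns \<otimes>\<^bsub>H\<^esub> x [^]\<^bsub>H\<^esub> (k::int)) = \<one>\<^bsub>H\<^esub>
    \<longleftrightarrow> k = 0 \<and> ns = [] \<and> (\<forall>m \<in> set ms. 2 * L dvd i m)"
proof -
  interpret faithful_lamp H x A B L \<epsilon> by (rule assms)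
  show ?thesis
    using normal_form_trivial[OF assms(3,4,2), of i k] trivial_normal_form[of k ns ms i] by blast
qed

text \<open>The subgroup of \<open>G \<times> H\<close> generated by the pairs of corresponding generators is the graph of the
  embedding: in normal form, an element of it is trivial in one coordinate iff it is in the other.\<close>

lemma faithful_lamp_embedding:
  assumes G: "faithful_lamp G x A B L \<epsilon>" and H: "faithful_lamp H x' A' B' L \<epsilon>" and L: "L = 2 ^ l"
  shows "\<exists>\<phi>. \<phi> \<in> mon (G\<lparr>carrier := generate G {x, A 0, B 0}\<rparr>) H"
proof -
  interpret G: faithful_lamp G x A B L \<epsilon> by (rule G)
  interpret H: faithful_lamp H x' A' B' L \<epsilon> by (rule H)
  define K where "K = G \<times>\<times> H"
  have fst: "fst \<in> hom K G" and snd: "snd \<in> hom K H"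
    by (auto simp: K_def hom_def DirProd_def)
  have grp: "group K" unfolding K_def by (rule DirProd_group) unfold_locales
  interpret F: group_hom K G fst
    by (intro group_hom.intro group_hom_axioms.intro grp G.is_group fst)
  interpret S: group_hom K H snd
    by (intro group_hom.intro group_hom_axioms.intro grp H.is_group snd)
  have pow: "(a, b) [^]\<^bsub>K\<^esub> (n::nat) = (a [^]\<^bsub>G\<^esub> n, b [^]\<^bsub>H\<^esub> n)" if "a \<in> carrier G" "b \<in> carrier H" for a b n
    by (induction n) (auto simp: K_def)
  \<comment> \<open>The relations hold coordinatewise in the product, so each element of
    \<open>P\<close> has one normal form whose exponents are shared by both coordinates.\<close>
  interpret K: lamp_relations K "(x, x')" "\<lambda>m. (A m, A' m)" "\<lambda>m. (B m, B' m)" L \<epsilon>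
    by unfold_locales
      (auto simp: pow, auto simp: K_def G.x_A H.x_A G.x_B H.x_B G.B_A H.B_A G.A_pow H.A_pow G.B_sq H.B_sq
         G.even_L G.pos_L intro: G.A_A H.A_A G.B_B H.B_B)
  define P where "P = generate K {(x, x'), (A 0, A' 0), (B 0, B' 0)}"
  have P_sub: "subgroup P K"
    unfolding P_def by (rule group.generate_is_subgroup[OF grp]) auto
  then interpret P: subgroup P K .
  have one_iff: "fst p = \<one>\<^bsub>G\<^esub> \<longleftrightarrow> snd p = \<one>\<^bsub>H\<^esub>" if p_in: "p \<in> P" for p
  proof -
    obtain i ms ns k where d: "distinct ms" "distinct ns" and
      p: "p = list_prod K (\<lambda>m. (A m, A' m) [^]\<^bsub>K\<^esub> (i m :: nat)) ms \<otimes>\<^bsub>K\<^esub>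
        (list_prod K (\<lambda>m. (B m, B' m)) ns \<otimes>\<^bsub>K\<^esub> (x, x') [^]\<^bsub>K\<^esub> (k::int))"
      using p_in K.generate_normal_forms
      unfolding P_def K.normal_forms_def K.A_forms_def by blast
    have "fst p = list_prod G (\<lambda>m. A m [^]\<^bsub>G\<^esub> (i m :: nat)) ms \<otimes>\<^bsub>G\<^esub> (list_prod G B ns \<otimes>\<^bsub>G\<^esub> x [^]\<^bsub>G\<^esub> k)"
      using K.A_form_closed[of i ms] unfolding p
      by (simp add: F.hom_int_pow F.hom_nat_pow list_prod_hom(1)[OF grp G.is_group fst])
    moreover have "snd p = list_prod H (\<lambda>m. A' m [^]\<^bsub>H\<^esub> (i m :: nat)) ms \<otimes>\<^bsub>H\<^esub> (list_prod H B' ns \<otimes>\<^bsub>H\<^esub> x' [^]\<^bsub>H\<^esub> k)"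
      using K.A_form_closed[of i ms] unfolding p
      by (simp add: S.hom_int_pow S.hom_nat_pow list_prod_hom(1)[OF grp H.is_group snd])
    ultimately show ?thesis
      using faithful_lamp_normal_form_iff[OF G L d] faithful_lamp_normal_form_iff[OF H L d] by simp
  qed
  have graph: "fst p = fst q \<longleftrightarrow> snd p = snd q" if "p \<in> P" "q \<in> P" for p q
  proof -
    have c: "p \<in> carrier K" "q \<in> carrier K" using that P.subset by auto
    have "p \<otimes>\<^bsub>K\<^esub> inv\<^bsub>K\<^esub> q \<in> P" using that by simp
    then have "fst p \<otimes>\<^bsub>G\<^esub> inv\<^bsub>G\<^esub> fst q = \<one>\<^bsub>G\<^esub> \<longleftrightarrow> snd p \<otimes>\<^bsub>H\<^esub> inv\<^bsub>H\<^esub> snd q = \<one>\<^bsub>H\<^esub>"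
      using one_iff[of "p \<otimes>\<^bsub>K\<^esub> inv\<^bsub>K\<^esub> q"] c by simp
    then show ?thesis
      using c F.hom_closed[OF c(1)] F.hom_closed[OF c(2)] S.hom_closed[OF c(1)] S.hom_closed[OF c(2)]
      by (simp add: G.eq_one_iff_div H.eq_one_iff_div)
  qed
  have onto: "\<exists>p \<in> P. fst p = g" if "g \<in> generate G {x, A 0, B 0}" for g
    using that
  proof (induction rule: generate.induct)
    case one
    then show ?case using P.one_closed F.hom_one by (intro bexI[of _ "\<one>\<^bsub>K\<^esub>"])
  next
    case (incl h)
    then have "h \<in> fst ` {(x, x'), (A 0, A' 0), (B 0, B' 0)}" by simp
    then obtain p where "p \<in> {(x, x'), (A 0, A' 0), (B 0, B' 0)}" "fst p = h" by blast
    moreover from this have "p \<in> P" unfolding P_def by (intro generate.incl)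
    ultimately show ?case by blast
  next
    case (inv h)
    then have "h \<in> fst ` {(x, x'), (A 0, A' 0), (B 0, B' 0)}" by simp
    then obtain p where "p \<in> {(x, x'), (A 0, A' 0), (B 0, B' 0)}" "fst p = h" by blast
    moreover from this have "inv\<^bsub>K\<^esub> p \<in> P" unfolding P_def by (intro generate.inv)
    moreover have "p \<in> carrier K" using calculation(1) by auto
    ultimately show ?case using F.hom_inv by blast
  next
    case (eng h1 h2)
    obtain p where p: "p \<in> P" "fst p = h1" using eng.IH(1) by blast
    obtain q where q: "q \<in> P" "fst q = h2" using eng.IH(2) by blast
    have "fst (p \<otimes>\<^bsub>K\<^esub> q) = h1 \<otimes>\<^bsub>G\<^esub> h2"
      using F.hom_mult[OF P.mem_carrier[OF p(1)] P.mem_carrier[OF q(1)]] p q by simp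
    then show ?case using P.m_closed[OF p(1) q(1)] by blast
  qed
  \<comment> \<open>From left to right \<open>graph\<close> makes this choice harmless; from right
    to left it gives injectivity.\<close>
  define \<phi> where "\<phi> g = snd (SOME p. p \<in> P \<and> fst p = g)" for g
  have \<phi>: "\<phi> (fst p) = snd p" if "p \<in> P" for p
  proof -
    let ?q = "SOME q. q \<in> P \<and> fst q = fst p"
    have "?q \<in> P \<and> fst ?q = fst p"
      by (rule someI[of "\<lambda>q. q \<in> P \<and> fst q = fst p" p]) (simp add: that)
    then show ?thesis using graph[of ?q p] that by (simp add: \<phi>_def)
  qed
  have "\<phi> \<in> hom (G\<lparr>carrier := generate G {x, A 0, B 0}\<rparr>) H"
  proof (rule homI)
    fix g assume "g \<in> carrier (G\<lparr>carrier := generate G {x, A 0, B 0}\<rparr>)"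
    then have "g \<in> generate G {x, A 0, B 0}" by simp
    then obtain p where "p \<in> P" "fst p = g" using onto[of g] by blast
    then show "\<phi> g \<in> carrier H" using \<phi>[of p] S.hom_closed[OF P.mem_carrier] by auto
  next
    fix g h assume "g \<in> carrier (G\<lparr>carrier := generate G {x, A 0, B 0}\<rparr>)"
      "h \<in> carrier (G\<lparr>carrier := generate G {x, A 0, B 0}\<rparr>)"
    then have "g \<in> generate G {x, A 0, B 0}" "h \<in> generate G {x, A 0, B 0}" by simp_all
    then obtain p q where pq: "p \<in> P" "fst p = g" "q \<in> P" "fst q = h"
      using onto[of g] onto[of h] by blast
    then have "p \<otimes>\<^bsub>K\<^esub> q \<in> P" "fst (p \<otimes>\<^bsub>K\<^esub> q) = g \<otimes>\<^bsub>G\<^esub> h" "snd (p \<otimes>\<^bsub>K\<^esub> q) = snd p \<otimes>\<^bsub>H\<^esub> snd q"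
      using P.m_closed[OF pq(1,3)] F.hom_mult[OF P.mem_carrier[OF pq(1)] P.mem_carrier[OF pq(3)]]
        S.hom_mult[OF P.mem_carrier[OF pq(1)] P.mem_carrier[OF pq(3)]]
      by simp_all
    then show "\<phi> (g \<otimes>\<^bsub>G\<lparr>carrier := generate G {x, A 0, B 0}\<rparr>\<^esub> h) = \<phi> g \<otimes>\<^bsub>H\<^esub> \<phi> h"
      using \<phi>[OF pq(1)] \<phi>[OF pq(3)] \<phi>[of "p \<otimes>\<^bsub>K\<^esub> q"] unfolding pq by simp
  qed
  moreover have "inj_on \<phi> (generate G {x, A 0, B 0})"
  proof (rule inj_onI)
    fix g h assume gh: "g \<in> generate G {x, A 0, B 0}" "h \<in> generate G {x, A 0, B 0}" and eq: "\<phi> g = \<phi> h"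
    obtain p where p: "p \<in> P" "fst p = g" using onto gh by blast
    obtain q where q: "q \<in> P" "fst q = h" using onto gh by blast
    have "snd p = snd q" using eq \<phi>[OF p(1)] \<phi>[OF q(1)] p q by simp
    then show "g = h" using graph[OF p(1) q(1)] p q by simp
  qed
  ultimately show ?thesis by (auto simp: mon_def)
qed

section \<open>The Cayley machine of a group with central commutators of order two\<close>

locale central_commutator_group = group G for G (structure) +
  fixes z
  assumes z_closed [simp, intro]: "z \<in> carrier G"
    and z_ne_one: "z \<noteq> \<one>"
    and z_sq: "z \<otimes> z = \<one>"
    and z_central: "g \<in> carrier G \<Longrightarrow> g \<otimes> z = z \<otimes> g"
    and commutator: "g \<in> carrier G \<Longrightarrow> h \<in> carrier G \<Longrightarrow> g \<otimes> h = h \<otimes> g \<or> g \<otimes> h = z \<otimes> (h \<otimes> g)"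
begin

definition zpow :: "bit \<Rightarrow> 'a" where "zpow b = (if b = 0 then \<one> else z)"

definition comm_exp :: "'a \<Rightarrow> 'a \<Rightarrow> bit" where
  "comm_exp g h = (if g \<otimes> h = h \<otimes> g then 0 else 1)"

lemma zpow_simps [simp]: "zpow 0 = \<one>" "zpow 1 = z"
  by (simp_all add: zpow_def)

lemma zpow_closed [simp, intro]: "zpow b \<in> carrier G"
  by (simp add: zpow_def)

lemma zpow_add: "zpow (b + c) = zpow b \<otimes> zpow c"
  by (cases b; cases c) (auto simp: z_sq)

lemma zpow_inject: "zpow b = zpow c \<longleftrightarrow> b = c"
  using z_ne_one by (cases b; cases c) auto

lemma zpow_comm: "g \<in> carrier G \<Longrightarrow> g \<otimes> zpow b = zpow b \<otimes> g"
  by (cases b) (auto simp: z_central)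

lemma zpow_lcomm: "g \<in> carrier G \<Longrightarrow> h \<in> carrier G \<Longrightarrow> g \<otimes> (zpow b \<otimes> h) = zpow b \<otimes> (g \<otimes> h)"
  using zpow_comm by (metis m_assoc zpow_closed)

lemma comm_exp_eq: "g \<in> carrier G \<Longrightarrow> h \<in> carrier G \<Longrightarrow> g \<otimes> h = zpow (comm_exp g h) \<otimes> (h \<otimes> g)"
  using commutator by (auto simp: comm_exp_def)

lemma comm_exp_unique:
  assumes "g \<in> carrier G" "h \<in> carrier G" "g \<otimes> h = zpow b \<otimes> (h \<otimes> g)"
  shows "comm_exp g h = b"
proof -
  have "zpow (comm_exp g h) \<otimes> (h \<otimes> g) = zpow b \<otimes> (h \<otimes> g)"
    using assms comm_exp_eq by metis
  then show ?thesis using assms by (simp add: zpow_inject)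
qed

lemma comm_exp_sym: "g \<in> carrier G \<Longrightarrow> h \<in> carrier G \<Longrightarrow> comm_exp g h = comm_exp h g"
  by (simp add: comm_exp_def eq_commute)

text \<open>Since commutators are central, commutation with a fixed \<open>h\<close> is a
  homomorphism into {e, z}. This additivity lets the exponents of z be computed by linear algebra
  over the integers mod 2.\<close>

lemma comm_exp_mult:
  assumes "g \<in> carrier G" "g' \<in> carrier G" "h \<in> carrier G"
  shows "comm_exp (g \<otimes> g') h = comm_exp g h + comm_exp g' h"
proof (rule comm_exp_unique)
  have "g \<otimes> g' \<otimes> h = g \<otimes> (zpow (comm_exp g' h) \<otimes> (h \<otimes> g'))"
    using assms comm_exp_eq[of g' h] by (simp add: m_assoc)
  also have "\<dots> = zpow (comm_exp g' h) \<otimes> (g \<otimes> h \<otimes> g')"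
    using assms by (simp add: zpow_lcomm[of g] m_assoc)
  also have "\<dots> = zpow (comm_exp g' h) \<otimes> (zpow (comm_exp g h) \<otimes> (h \<otimes> (g \<otimes> g')))"
    using assms by (simp add: comm_exp_eq[of g h]) (simp add: m_assoc)
  also have "\<dots> = zpow (comm_exp g' h + comm_exp g h) \<otimes> (h \<otimes> (g \<otimes> g'))"
    using assms by (simp add: zpow_add m_assoc)
  also have "comm_exp g' h + comm_exp g h = comm_exp g h + comm_exp g' h"
    by (rule add.commute)
  finally show "g \<otimes> g' \<otimes> h = zpow (comm_exp g h + comm_exp g' h) \<otimes> (h \<otimes> (g \<otimes> g'))" .
qed (use assms in auto)

lemma comm_exp_pow_right:
  assumes "g \<in> carrier G" "h \<in> carrier G"
  shows "g \<otimes> h [^] (n::nat) = zpow (of_nat n * comm_exp g h) \<otimes> (h [^] n \<otimes> g)"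
proof (induction n)
  case (Suc n)
  let ?b = "comm_exp g h"
  have "g \<otimes> h [^] Suc n = g \<otimes> h [^] n \<otimes> h" using assms by (simp add: m_assoc)
  also have "\<dots> = zpow (of_nat n * ?b) \<otimes> (h [^] n \<otimes> (g \<otimes> h))"
    unfolding Suc using assms by (simp add: m_assoc)
  also have "g \<otimes> h = zpow ?b \<otimes> (h \<otimes> g)" by (rule comm_exp_eq) (use assms in auto)
  also have "zpow (of_nat n * ?b) \<otimes> (h [^] n \<otimes> (zpow ?b \<otimes> (h \<otimes> g))) =
      zpow (of_nat n * ?b + ?b) \<otimes> (h [^] Suc n \<otimes> g)"
    using assms by (simp add: zpow_lcomm[of "h [^] n"] zpow_add m_assoc)
  moreover have "of_nat n * ?b + ?b = of_nat (Suc n) * ?b" by (simp add: algebra_simps)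
  ultimately show ?case by simp
qed (use assms in simp)

section \<open>The action of the machine on infinite words\<close>

abbreviation (input) "words \<equiv> omega_words (carrier G)"
abbreviation (input) "S \<equiv> BijGroup (omega_words (carrier G))"

definition step :: "(nat \<Rightarrow> 'a) \<Rightarrow> (nat \<Rightarrow> 'a)" where
  "step = state_action (cayley_machine G) \<one>"

text \<open>This is \<alpha>_g, defined through the states so that it is a group element at once;
  \<open>head_mult_apply\<close> identifies its action.\<close>

definition head_mult :: "'a \<Rightarrow> (nat \<Rightarrow> 'a) \<Rightarrow> (nat \<Rightarrow> 'a)" where
  "head_mult g = inv\<^bsub>S\<^esub> step \<otimes>\<^bsub>S\<^esub> state_action (cayley_machine G) g"

lemma group_S: "group S"
  by (rule group_BijGroup)

sublocale S: group S
  by (rule group_S)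

lemma S_mult: "\<sigma> \<in> carrier S \<Longrightarrow> \<tau> \<in> carrier S \<Longrightarrow> w \<in> words \<Longrightarrow> (\<sigma> \<otimes>\<^bsub>S\<^esub> \<tau>) w = \<sigma> (\<tau> w)"
  by (simp add: BijGroup_def compose_def)

lemma S_one: "w \<in> words \<Longrightarrow> \<one>\<^bsub>S\<^esub> w = w"
  by (simp add: BijGroup_def)

lemma S_closed: "\<sigma> \<in> carrier S \<Longrightarrow> w \<in> words \<Longrightarrow> \<sigma> w \<in> words"
  by (auto simp: BijGroup_def Bij_def bij_betw_def)

lemma S_inj: "\<sigma> \<in> carrier S \<Longrightarrow> v \<in> words \<Longrightarrow> w \<in> words \<Longrightarrow> \<sigma> v = \<sigma> w \<Longrightarrow> v = w"
  by (auto simp: BijGroup_def Bij_def bij_betw_def dest: inj_onD)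

lemma S_surj: "\<sigma> \<in> carrier S \<Longrightarrow> w \<in> words \<Longrightarrow> \<exists>v \<in> words. \<sigma> v = w"
  unfolding BijGroup_def Bij_def bij_betw_def by (simp, metis imageE)

lemma S_ext:
  "\<sigma> \<in> carrier S \<Longrightarrow> \<tau> \<in> carrier S \<Longrightarrow> (\<And>w. w \<in> words \<Longrightarrow> \<sigma> w = \<tau> w) \<Longrightarrow> \<sigma> = \<tau>"
  by (auto simp: BijGroup_def Bij_def intro: extensionalityI)

lemma words_closed: "w \<in> words \<Longrightarrow> w n \<in> carrier G"
  by (auto simp: omega_words_def)

lemma wordsI: "(\<And>n. w n \<in> carrier G) \<Longrightarrow> w \<in> words"
  by (auto simp: omega_words_def)

lemma state_action_closed [simp, intro]: "g \<in> carrier G \<Longrightarrow> state_action (cayley_machine G) g \<in> carrier S"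
  using state_action_cayley_Bij by (simp add: BijGroup_def)

lemma step_closed [simp, intro]: "step \<in> carrier S"
  by (simp add: step_def)

lemma head_mult_closed [simp, intro]: "g \<in> carrier G \<Longrightarrow> head_mult g \<in> carrier S"
  by (simp add: head_mult_def)

lemma step_head_mult: "g \<in> carrier G \<Longrightarrow> step \<otimes>\<^bsub>S\<^esub> head_mult g = state_action (cayley_machine G) g"
  unfolding head_mult_def by (simp flip: S.m_assoc)

lemma step_0: "w \<in> words \<Longrightarrow> step w 0 = w 0"
  by (simp add: step_def state_action_cayley words_closed)

lemma step_Suc: "w \<in> words \<Longrightarrow> step w (Suc n) = step w n \<otimes> w (Suc n)"
  by (simp add: step_def state_action_cayley words_closed)

definition on_head :: "'a \<Rightarrow> (nat \<Rightarrow> 'a) \<Rightarrow> nat \<Rightarrow> 'a" where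
  "on_head g w k = (if k = 0 then g \<otimes> w 0 else w k)"

lemma on_head_simps [simp]: "on_head g w 0 = g \<otimes> w 0" "on_head g w (Suc k) = w (Suc k)"
  by (simp_all add: on_head_def)

lemma on_head_words: "g \<in> carrier G \<Longrightarrow> w \<in> words \<Longrightarrow> on_head g w \<in> words"
  by (intro wordsI) (simp add: on_head_def words_closed)

text \<open>Both sides have the same image under the injective \<open>step\<close>: the partial
  products of a word with first letter multiplied by \<open>g\<close> are the output of state
  \<open>g\<close>.\<close>

lemma head_mult_apply:
  assumes g: "g \<in> carrier G" and w: "w \<in> words"
  shows "head_mult g w = on_head g w"
proof -
  have v: "on_head g w \<in> words" using g w by (rule on_head_words)
  have "step (on_head g w) n = state_action (cayley_machine G) g w n" for n
    by (induction n) (simp_all add: step_0[OF v] step_Suc[OF v] state_action_cayley[OF w])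
  then have "step (on_head g w) = (step \<otimes>\<^bsub>S\<^esub> head_mult g) w"
    using g by (auto simp: step_head_mult)
  also have "\<dots> = step (head_mult g w)" using g w by (simp add: S_mult)
  finally show ?thesis
    using S_inj[OF step_closed v, of "head_mult g w"] S_closed[OF head_mult_closed[OF g] w] by simp
qed

lemma head_mult_mult:
  assumes "g \<in> carrier G" "h \<in> carrier G"
  shows "head_mult (g \<otimes> h) = head_mult g \<otimes>\<^bsub>S\<^esub> head_mult h"
proof (rule S_ext)
  fix w assume w: "w \<in> words"
  show "head_mult (g \<otimes> h) w = (head_mult g \<otimes>\<^bsub>S\<^esub> head_mult h) w"
    using assms w words_closed[OF w]
    by (auto simp: S_mult head_mult_apply on_head_words on_head_def m_assoc fun_eq_iff)
qed (use assms in auto)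

lemma head_mult_one: "head_mult \<one> = \<one>\<^bsub>S\<^esub>"
  by (simp add: head_mult_def flip: step_def)

lemma head_mult_pow: "g \<in> carrier G \<Longrightarrow> head_mult g [^]\<^bsub>S\<^esub> (n::nat) = head_mult (g [^] n)"
  by (induction n) (simp_all add: head_mult_one head_mult_mult)

section \<open>Conjugates by powers of \<open>step\<close>\<close>

definition conj_step :: "int \<Rightarrow> ((nat \<Rightarrow> 'a) \<Rightarrow> (nat \<Rightarrow> 'a)) \<Rightarrow> ((nat \<Rightarrow> 'a) \<Rightarrow> (nat \<Rightarrow> 'a))" where
  "conj_step m \<sigma> = step [^]\<^bsub>S\<^esub> m \<otimes>\<^bsub>S\<^esub> \<sigma> \<otimes>\<^bsub>S\<^esub> inv\<^bsub>S\<^esub> (step [^]\<^bsub>S\<^esub> m)"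

lemma conj_step_closed [simp, intro]: "\<sigma> \<in> carrier S \<Longrightarrow> conj_step m \<sigma> \<in> carrier S"
  by (simp add: conj_step_def)

lemma conj_step_mult:
  "\<sigma> \<in> carrier S \<Longrightarrow> \<tau> \<in> carrier S \<Longrightarrow> conj_step m (\<sigma> \<otimes>\<^bsub>S\<^esub> \<tau>) = conj_step m \<sigma> \<otimes>\<^bsub>S\<^esub> conj_step m \<tau>"
  unfolding conj_step_def by (simp add: S.m_assoc S.inv_solve_left)

lemma conj_step_one: "conj_step m \<one>\<^bsub>S\<^esub> = \<one>\<^bsub>S\<^esub>"
  by (simp add: conj_step_def)

lemma conj_step_zero: "\<sigma> \<in> carrier S \<Longrightarrow> conj_step 0 \<sigma> = \<sigma>"
  by (simp add: conj_step_def)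

lemma conj_step_add: "\<sigma> \<in> carrier S \<Longrightarrow> conj_step m (conj_step n \<sigma>) = conj_step (m + n) \<sigma>"
  unfolding conj_step_def by (simp add: S.int_pow_mult S.inv_mult_group S.m_assoc)

lemma conj_step_pow: "\<sigma> \<in> carrier S \<Longrightarrow> conj_step m \<sigma> [^]\<^bsub>S\<^esub> (n::nat) = conj_step m (\<sigma> [^]\<^bsub>S\<^esub> n)"
  by (induction n) (simp_all add: conj_step_one conj_step_mult)

lemma step_conj_step: "\<sigma> \<in> carrier S \<Longrightarrow> step \<otimes>\<^bsub>S\<^esub> conj_step m \<sigma> = conj_step (m + 1) \<sigma> \<otimes>\<^bsub>S\<^esub> step"
proof -
  assume s: "\<sigma> \<in> carrier S"
  have "conj_step (m + 1) \<sigma> = conj_step 1 (conj_step m \<sigma>)"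
    using s by (simp add: conj_step_add add.commute)
  then show ?thesis
    using s by (simp add: conj_step_def[of 1] S.int_pow_1 S.m_assoc)
qed

text \<open>Every word is some \<open>step v\<close>, and evaluating there replaces the inverse of
  \<open>step\<close> by the intertwining \<open>step (F v) = F' (step v)\<close>.\<close>

lemma conj_stepI:
  assumes "\<sigma> \<in> carrier S" "\<And>w. w \<in> words \<Longrightarrow> conj_step m \<sigma> w = F w"
    and "\<And>w. w \<in> words \<Longrightarrow> step (F w) = F' (step w)" "w \<in> words"
  shows "conj_step (m + 1) \<sigma> w = F' w"
proof -
  obtain v where v: "v \<in> words" "step v = w" using S_surj[OF step_closed assms(4)] by blast
  have "conj_step (m + 1) \<sigma> w = (conj_step (m + 1) \<sigma> \<otimes>\<^bsub>S\<^esub> step) v"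
    using v assms by (simp add: S_mult)
  also have "\<dots> = step (conj_step m \<sigma> v)"
    using v assms(1) by (simp add: S_mult flip: step_conj_step)
  also have "\<dots> = F' w" using assms(2,3) v by simp
  finally show ?thesis .
qed

definition twisted :: "'a \<Rightarrow> nat \<Rightarrow> (nat \<Rightarrow> 'a) \<Rightarrow> nat \<Rightarrow> 'a" where
  "twisted h n w k = zpow (\<Sum>i<k. twist n k i * comm_exp (w i) h) \<otimes> (h [^] pascal_sum n k \<otimes> w k)"

lemma twisted_words: "h \<in> carrier G \<Longrightarrow> w \<in> words \<Longrightarrow> twisted h n w \<in> words"
  by (intro wordsI) (simp add: twisted_def words_closed)

text \<open>The origin of the recursion for \<open>twist\<close>. Letter \<open>Suc k\<close> on the
  left is the previous letter times a letter of \<open>twisted h n w\<close>. The previous letter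
  contributes \<open>twist (Suc n) k i\<close>, rewriting \<open>w\<close> in the letters of
  \<open>y = step w\<close> contributes \<open>twist n (Suc k)\<close> at \<open>i\<close> and
  \<open>Suc i\<close>, and moving \<open>y k\<close> past a power of \<open>h\<close> contributes
  the term at \<open>i = k\<close>.\<close>

lemma step_twisted:
  assumes h: "h \<in> carrier G" and w: "w \<in> words"
  shows "step (twisted h n w) = twisted h (Suc n) (step w)"
proof
  fix k
  define y where "y = step w"
  have y: "y \<in> words" using S_closed[OF step_closed w] by (simp add: y_def)
  note wc = words_closed[OF w] words_closed[OF y]
  note tw = twisted_words[OF h w, of n]
  show "step (twisted h n w) k = twisted h (Suc n) (step w) k"
  proof (induction k)
    case 0
    then show ?case using h w words_closed[OF w] by (simp add: step_0 tw) (simp add: twisted_def step_0)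
  next
    case (Suc k)
    let ?\<omega> = "\<lambda>i. comm_exp (y i) h"
    have y0: "y 0 = w 0" using w by (simp add: y_def step_0)
    have yS: "y (Suc i) = y i \<otimes> w (Suc i)" for i using w by (simp add: y_def step_Suc)
    have \<omega>w: "comm_exp (w (Suc i)) h = ?\<omega> i + ?\<omega> (Suc i)" for i
      unfolding yS using comm_exp_mult[of "y i" "w (Suc i)" h] h wc by simp
    let ?T = "twist n (Suc k)"
    \<comment> \<open>Summation by parts, because \<open>w (Suc i)\<close> contributes the exponents
      of both \<open>y i\<close> and \<open>y (Suc i)\<close>. The boundary term vanishes as
      \<open>twist\<close> is triangular.\<close>
    have sum: "(\<Sum>i<Suc k. ?T i * comm_exp (w i) h) = (\<Sum>i<Suc k. (?T i + ?T (Suc i)) * ?\<omega> i)"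
    proof -
      have "(\<Sum>i<j. (?T i + ?T (Suc i)) * ?\<omega> i) = (\<Sum>i<j. ?T i * comm_exp (w i) h) + (if j = 0 then 0 else ?T j * ?\<omega> (j - 1))" for j
      proof (induction j)
        case (Suc j)
        then show ?case
          by (cases j) (simp_all add: \<omega>w y0 algebra_simps)
      qed simp
      from this[of "Suc k"] show ?thesis by (simp add: twist_triangular)
    qed
    let ?s' = "\<Sum>i<k. twist (Suc n) k i * ?\<omega> i" and ?s = "\<Sum>i<Suc k. (?T i + ?T (Suc i)) * ?\<omega> i"
    let ?e = "pascal_sum n (Suc k)" and ?e' = "pascal_sum (Suc n) k"
    have S: "(\<Sum>i<Suc k. twist (Suc n) (Suc k) i * ?\<omega> i) = ?s' + ?s + of_nat ?e * ?\<omega> k"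
      by (simp add: sum.distrib algebra_simps twist_triangular)
    have "step (twisted h n w) (Suc k) = twisted h (Suc n) y k \<otimes> twisted h n w (Suc k)"
      using Suc by (simp add: step_Suc tw y_def)
    also have "\<dots> = (zpow ?s' \<otimes> (h [^] ?e' \<otimes> y k)) \<otimes> (zpow ?s \<otimes> (h [^] ?e \<otimes> w (Suc k)))"
      unfolding twisted_def sum ..
    also have "\<dots> = zpow ?s' \<otimes> (zpow ?s \<otimes> (h [^] ?e' \<otimes> ((y k \<otimes> h [^] ?e) \<otimes> w (Suc k))))"
      using h wc by (simp add: m_assoc zpow_lcomm[of "h [^] ?e'"] zpow_lcomm[of "y k"])
    also have "\<dots> = zpow ?s' \<otimes> (zpow ?s \<otimes> (zpow (of_nat ?e * ?\<omega> k) \<otimes> (h [^] ?e' \<otimes> (h [^] ?e \<otimes> (y k \<otimes> w (Suc k))))))"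
      using h wc by (simp add: comm_exp_pow_right m_assoc zpow_lcomm[of "h [^] ?e'"])
    also have "\<dots> = zpow (?s' + ?s + of_nat ?e * ?\<omega> k) \<otimes> (h [^] pascal_sum (Suc n) (Suc k) \<otimes> y (Suc k))"
      using h wc by (simp add: zpow_add m_assoc yS nat_pow_mult flip: m_assoc[of "h [^] ?e'"])
    finally show ?case unfolding twisted_def S y_def[symmetric] .
  qed
qed

lemma twisted_0: "h \<in> carrier G \<Longrightarrow> w \<in> words \<Longrightarrow> twisted h 0 w = on_head h w"
  by (auto simp: twisted_def on_head_def fun_eq_iff words_closed)

lemma conj_head_mult: "h \<in> carrier G \<Longrightarrow> w \<in> words \<Longrightarrow> conj_step (int n) (head_mult h) w = twisted h n w"
proof (induction n arbitrary: w)
  case 0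
  then show ?case by (simp add: conj_step_zero head_mult_apply twisted_0)
next
  case (Suc n)
  then show ?case
    using conj_stepI[of "head_mult h" "int n" "twisted h n" "twisted h (Suc n)" w] step_twisted[of h _ n]
    by (simp add: add.commute)
qed

section \<open>Multiplication of letters by powers of \<open>z\<close>, and commutators\<close>

definition central_mult :: "(nat \<Rightarrow> bit) \<Rightarrow> (nat \<Rightarrow> 'a) \<Rightarrow> nat \<Rightarrow> 'a" where
  "central_mult f w k = zpow (f k) \<otimes> w k"

lemma central_mult_words: "w \<in> words \<Longrightarrow> central_mult f w \<in> words"
  by (intro wordsI) (simp add: central_mult_def words_closed)

text \<open>The factors z are central, so \<open>step\<close> forms partial sums of their exponents:
  \<open>g\<close> is \<open>f\<close> divided by 1 - t as a power series.\<close>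

lemma step_central_mult:
  assumes "w \<in> words" "g 0 = f 0" "\<And>k. g (Suc k) = g k + f (Suc k)"
  shows "step (central_mult f w) = central_mult g (step w)"
proof
  fix k show "step (central_mult f w) k = central_mult g (step w) k"
  proof (induction k)
    case 0
    then show ?case using assms by (simp add: step_0 central_mult_words) (simp add: central_mult_def step_0)
  next
    case (Suc k)
    have "step w \<in> words" using S_closed[OF step_closed assms(1)] .
    then show ?case using assms(1) Suc words_closed[OF assms(1)] words_closed[OF \<open>step w \<in> words\<close>]
      by (simp add: step_Suc central_mult_words) (simp add: central_mult_def assms zpow_add zpow_lcomm[of "step w k"] m_assoc step_Suc[OF assms(1)])
  qed
qed

lemma head_mult_z: "w \<in> words \<Longrightarrow> head_mult z w = central_mult (\<lambda>k. if k = 0 then 1 else 0) w"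
  by (auto simp: head_mult_apply on_head_def central_mult_def words_closed)

text \<open>\<open>comm_coeff_step\<close> says that passing from \<open>n\<close> to
  \<open>n + 2\<close> forms partial sums, that is, conjugates once more by \<open>step\<close>.
  Both \<open>n = 0\<close> and \<open>n = 1\<close> start from \<open>head_mult z\<close>
  itself.\<close>

lemma conj_head_mult_z: "w \<in> words \<Longrightarrow> conj_step (int (n div 2)) (head_mult z) w = central_mult (comm_coeff n) w"
proof (induction n arbitrary: w rule: less_induct)
  case (less n)
  show ?case
  proof (cases "n \<le> 1")
    case True
    then have "comm_coeff n = (\<lambda>k. if k = 0 then 1 else 0)" using comm_coeff_small by auto
    then show ?thesis using True less(2) by (auto simp: conj_step_zero head_mult_z)
  next
    case False
    then obtain j where n: "n = Suc (Suc j)" by (metis One_nat_def le_SucI less_eq_nat.simps(1) not0_implies_Suc order_refl)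
    have IH: "conj_step (int (j div 2)) (head_mult z) v = central_mult (comm_coeff j) v" if "v \<in> words" for v
      using less(1) that n by simp
    have "conj_step (int (j div 2) + 1) (head_mult z) w = central_mult (comm_coeff n) w"
    proof (rule conj_stepI[OF _ IH _ less(2)])
      show "step (central_mult (comm_coeff j) v) = central_mult (comm_coeff n) (step v)" if "v \<in> words" for v
        using that unfolding n by (rule step_central_mult) (simp_all only: comm_coeff_step, simp add: comm_coeff_def)
    qed auto
    then show ?thesis by (simp add: n add.commute)
  qed
qed

text \<open>In the first letter [g, h] appears directly. In a later letter \<open>k\<close>,
  replacing \<open>w 0\<close> by \<open>g \<otimes> w 0\<close> changes only the summand
  \<open>i = 0\<close> of the exponent in \<open>twisted\<close>, by \<open>twist n k 0\<close>
  times \<open>comm_exp g h\<close>. Together these are the coefficients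
  \<open>comm_coeff n\<close>.\<close>

lemma head_mult_commutator_nat:
  assumes g: "g \<in> carrier G" and h: "h \<in> carrier G"
  shows "head_mult g \<otimes>\<^bsub>S\<^esub> conj_step (int n) (head_mult h) =
    conj_step (int n div 2) (head_mult (zpow (comm_exp g h))) \<otimes>\<^bsub>S\<^esub> conj_step (int n) (head_mult h) \<otimes>\<^bsub>S\<^esub> head_mult g"
proof (rule S_ext)
  fix w assume w: "w \<in> words"
  let ?b = "comm_exp g h"
  note wc = words_closed[OF w]
  let ?v = "twisted h n w" and ?u = "on_head g w"
  have u: "?u \<in> words" using g w by (rule on_head_words)
  have Z: "conj_step (int n div 2) (head_mult (zpow ?b)) v = central_mult (\<lambda>k. ?b * comm_coeff n k) v" if "v \<in> words" for v
  proof (cases "?b = 0")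
    case True
    then show ?thesis using that by (simp add: head_mult_one conj_step_one S_one central_mult_def fun_eq_iff words_closed)
  next
    case False
    then have "?b = 1" by simp
    then show ?thesis using conj_head_mult_z[OF that, of n] by (simp add: zdiv_int)
  qed
  have l: "(head_mult g \<otimes>\<^bsub>S\<^esub> conj_step (int n) (head_mult h)) w = on_head g ?v"
    using g h w by (simp add: S_mult conj_head_mult head_mult_apply twisted_words)
  have r: "(conj_step (int n div 2) (head_mult (zpow ?b)) \<otimes>\<^bsub>S\<^esub> conj_step (int n) (head_mult h) \<otimes>\<^bsub>S\<^esub> head_mult g) w
      = central_mult (\<lambda>k. ?b * comm_coeff n k) (twisted h n ?u)"
    using g h w u by (simp add: S_mult conj_head_mult head_mult_apply twisted_words Z)
  have "(on_head g ?v) k = central_mult (\<lambda>k. ?b * comm_coeff n k) (twisted h n ?u) k" for k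
  proof (cases k)
    case 0
    have "g \<otimes> (h \<otimes> w 0) = zpow ?b \<otimes> (h \<otimes> (g \<otimes> w 0))"
      using comm_exp_eq[OF g h] g h wc by (simp flip: m_assoc)
    then show ?thesis using g h wc by (simp add: 0 twisted_def central_mult_def comm_coeff_def)
  next
    case (Suc j)
    have c: "comm_exp (?u i) h = comm_exp (w i) h + (if i = 0 then ?b else 0)" for i
      using comm_exp_mult[OF g _ h] wc by (cases i) (simp_all add: add.commute)
    have "(\<Sum>i<k. twist n k i * comm_exp (?u i) h) =
        (\<Sum>i<k. twist n k i * comm_exp (w i) h) + (\<Sum>i<k. twist n k i * (if i = 0 then ?b else 0))"
      unfolding c by (simp only: distrib_left sum.distrib)
    also have "(\<Sum>i<k. twist n k i * (if i = 0 then ?b else 0)) = twist n k 0 * ?b"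
      using Suc by (subst sum.remove[of _ 0]) auto
    finally have s: "(\<Sum>i<k. twist n k i * comm_exp (?u i) h) = twist n k 0 * ?b + (\<Sum>i<k. twist n k i * comm_exp (w i) h)"
      by (simp only: add.commute)
    have "twisted h n ?u k = zpow (twist n k 0 * ?b) \<otimes> ?v k"
      using Suc h wc unfolding twisted_def s by (simp add: zpow_add m_assoc on_head_def)
    then have "central_mult (\<lambda>k. ?b * comm_coeff n k) (twisted h n ?u) k = zpow (?b * twist n k 0) \<otimes> (zpow (twist n k 0 * ?b) \<otimes> ?v k)"
      using Suc by (simp add: central_mult_def comm_coeff_def)
    also have "\<dots> = ?v k"
      using words_closed[OF twisted_words[OF h w]]
      by (simp add: mult.commute[of ?b] flip: m_assoc zpow_add)
    finally show ?thesis using Suc by simp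
  qed
  then show "(head_mult g \<otimes>\<^bsub>S\<^esub> conj_step (int n) (head_mult h)) w =
    (conj_step (int n div 2) (head_mult (zpow ?b)) \<otimes>\<^bsub>S\<^esub> conj_step (int n) (head_mult h) \<otimes>\<^bsub>S\<^esub> head_mult g) w"
    unfolding l r by blast
qed (use g h in auto)

text \<open>Conjugation by \<open>step\<close> to the power \<open>m\<close> extends the previous
  lemma to all \<open>m \<le> n\<close>, where \<open>m + (n - m) div 2 = (m + n) div 2\<close>. For
  \<open>m > n\<close> the two elements exchange roles and the involution changes sides.\<close>

lemma head_mult_commutator:
  assumes g: "g \<in> carrier G" and h: "h \<in> carrier G"
  shows "conj_step m (head_mult g) \<otimes>\<^bsub>S\<^esub> conj_step n (head_mult h) =
    conj_step ((m + n) div 2) (head_mult (zpow (comm_exp g h))) \<otimes>\<^bsub>S\<^esub> conj_step n (head_mult h) \<otimes>\<^bsub>S\<^esub> conj_step m (head_mult g)"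
proof -
  have *: "conj_step m (head_mult g) \<otimes>\<^bsub>S\<^esub> conj_step n (head_mult h) =
    conj_step ((m + n) div 2) (head_mult (zpow (comm_exp g h))) \<otimes>\<^bsub>S\<^esub> conj_step n (head_mult h) \<otimes>\<^bsub>S\<^esub> conj_step m (head_mult g)"
    if g: "g \<in> carrier G" and h: "h \<in> carrier G" and mn: "m \<le> n" for g h m n
  proof -
    define k where "k = nat (n - m)"
    have k: "n = m + int k" using mn by (simp add: k_def)
    have d: "m + int k div 2 = (m + n) div 2" unfolding k by presburger
    show ?thesis
      using arg_cong[OF head_mult_commutator_nat[OF g h, of k], of "conj_step m"] g h
      by (simp add: conj_step_mult conj_step_add d flip: k)
  qed
  show ?thesis
  proof (cases "m \<le> n")
    case False
    let ?z = "conj_step ((m + n) div 2) (head_mult (zpow (comm_exp g h)))"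
    have zz: "?z \<otimes>\<^bsub>S\<^esub> ?z = \<one>\<^bsub>S\<^esub>"
      by (simp add: conj_step_one head_mult_one flip: conj_step_mult head_mult_mult zpow_add)
    have "conj_step n (head_mult h) \<otimes>\<^bsub>S\<^esub> conj_step m (head_mult g) = ?z \<otimes>\<^bsub>S\<^esub> (conj_step m (head_mult g) \<otimes>\<^bsub>S\<^esub> conj_step n (head_mult h))"
      using *[OF h g, of n m] False g h by (simp add: comm_exp_sym[OF h g] add.commute S.m_assoc)
    then show ?thesis using g h zz by (simp add: S.m_assoc) (simp flip: S.m_assoc)
  qed (rule *[OF g h])
qed

text \<open>Undoing partial sums multiplies the exponent series by 1 - t, which is 1 + t mod 2. The
  binomial coefficients have finite support, unlike the series for positive powers.\<close>

lemma conj_neg_head_mult_z: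
  "w \<in> words \<Longrightarrow> conj_step (- int n) (head_mult z) w = central_mult (\<lambda>k. of_nat (n choose k)) w"
proof (induction n arbitrary: w)
  case 0
  then show ?case by (auto simp: conj_step_zero head_mult_z central_mult_def fun_eq_iff binomial_eq_0)
next
  case (Suc n)
  let ?F = "\<lambda>n. central_mult (\<lambda>k. of_nat (n choose k))"
  let ?c = "conj_step (- int (Suc n)) (head_mult z)"
  have "step (?c w) = (step \<otimes>\<^bsub>S\<^esub> ?c) w" using Suc.prems by (simp add: S_mult)
  also have "\<dots> = conj_step (- int n) (head_mult z) (step w)"
    using Suc.prems by (subst step_conj_step) (auto simp: S_mult)
  also have "\<dots> = ?F n (step w)"
    using Suc.IH[OF S_closed[OF step_closed Suc.prems]] .
  also have "\<dots> = step (?F (Suc n) w)"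
    by (rule step_central_mult[symmetric]) (auto simp: Suc.prems)
  finally show ?case
    using S_inj[OF step_closed] S_closed[of ?c w] Suc.prems central_mult_words by (metis conj_step_closed head_mult_closed z_closed)
qed

lemma list_prod_neg_head_mult_z:
  assumes "w \<in> words" "\<And>q. q \<in> set qs \<Longrightarrow> q \<le> 0"
  shows "list_prod S (\<lambda>q. conj_step q (head_mult z)) qs w = central_mult (\<lambda>k. \<Sum>q\<leftarrow>qs. of_nat (nat (- q) choose k)) w"
  using assms(2)
proof (induction qs)
  case Nil
  then show ?case using assms by (auto simp: S_one central_mult_def words_closed)
next
  case (Cons q qs)
  have "list_prod S (\<lambda>q. conj_step q (head_mult z)) qs \<in> carrier S"
    by (rule S.list_prod_closed) auto
  moreover have "conj_step q (head_mult z) (central_mult g w) = central_mult (\<lambda>k. of_nat (nat (- q) choose k)) (central_mult g w)" for g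
    using conj_neg_head_mult_z[OF central_mult_words[OF assms(1)], of "nat (- q)"] Cons.prems by simp
  moreover have "central_mult f (central_mult g w) = central_mult (\<lambda>k. f k + g k) w" for f g
    using words_closed[OF assms(1)] by (auto simp: central_mult_def zpow_add m_assoc)
  ultimately show ?case
    using Cons assms(1) by (simp add: S_mult)
qed

text \<open>After shifting by the largest index \<open>M\<close>, the factor of index
  \<open>r\<close> has exponent polynomial (1 + t)^(M - r). The smallest index \<open>q\<close> has
  the largest degree, so letter \<open>M - q\<close> sees its top coefficient alone.\<close>

lemma leading_head_mult_z:
  assumes "\<And>r. r \<in> set qs \<Longrightarrow> q < r"
  shows "list_prod S (\<lambda>q. conj_step q (head_mult z)) (q # qs) \<noteq> \<one>\<^bsub>S\<^esub>"
proof
  let ?P = "list_prod S (\<lambda>q. conj_step q (head_mult z))"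
  assume one: "?P (q # qs) = \<one>\<^bsub>S\<^esub>"
  define M where "M = Max (set (q # qs))"
  have M: "r \<le> M" if "r \<in> set (q # qs)" for r
    unfolding M_def using that by (intro Max_ge) auto
  have "conj_step (- M) (?P rs) = ?P (map (\<lambda>r. r - M) rs)" for rs
  proof (induction rs)
    case (Cons r rs)
    have "?P rs \<in> carrier S" by (rule S.list_prod_closed) auto
    then show ?case using Cons by (simp add: conj_step_mult conj_step_add)
  qed (simp add: conj_step_one)
  from this[of "q # qs"] have "?P (map (\<lambda>r. r - M) (q # qs)) = \<one>\<^bsub>S\<^esub>"
    unfolding one by (simp add: conj_step_one)
  moreover have w: "(\<lambda>_. \<one>) \<in> words" by (intro wordsI) auto
  moreover have le: "r \<le> 0" if "r \<in> set (map (\<lambda>r. r - M) (q # qs))" for r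
    using that M by auto
  ultimately have "central_mult (\<lambda>k. \<Sum>q\<leftarrow>map (\<lambda>r. r - M) (q # qs). of_nat (nat (- q) choose k)) (\<lambda>_. \<one>) = (\<lambda>_. \<one>)"
    using list_prod_neg_head_mult_z[OF w, of "map (\<lambda>r. r - M) (q # qs)"] le S_one[OF w] by metis
  from fun_cong[OF this, of "nat (M - q)"]
  have "zpow (\<Sum>r\<leftarrow>q # qs. of_nat (nat (M - r) choose nat (M - q))) = zpow 0"
    by (simp add: central_mult_def o_def)
  moreover have "(\<Sum>r\<leftarrow>qs. of_nat (nat (M - r) choose nat (M - q))) = (0::bit)"
  proof -
    have "nat (M - r) choose nat (M - q) = 0" if "r \<in> set qs" for r
      using assms[OF that] M[of r] that by (intro binomial_eq_0) auto
    then have "map (\<lambda>r. of_nat (nat (M - r) choose nat (M - q)) :: bit) qs = map (\<lambda>_. 0) qs"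
      by (metis (mono_tags, lifting) map_cong of_nat_0)
    then show ?thesis by (metis sum_list_0)
  qed
  ultimately show False unfolding zpow_inject by simp
qed

lemma faithful_lamp_automaton:
  assumes a: "a \<in> carrier G" and b: "b \<in> carrier G" and z: "a [^] L = z"
    and ba: "b \<otimes> a = z \<otimes> (a \<otimes> b)" and bb: "b \<otimes> b = (if \<epsilon> then z else \<one>)"
    and L: "even L" "0 < L"
  shows "faithful_lamp S step (\<lambda>m. conj_step m (head_mult a)) (\<lambda>m. conj_step m (head_mult b)) L \<epsilon>"
proof
  show "step \<in> carrier S" "even L" "0 < L" using L by auto
  show "conj_step m (head_mult a) \<in> carrier S" "conj_step m (head_mult b) \<in> carrier S" for m
    using a b by auto
  show "step \<otimes>\<^bsub>S\<^esub> conj_step m (head_mult a) = conj_step (m + 1) (head_mult a) \<otimes>\<^bsub>S\<^esub> step"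
    "step \<otimes>\<^bsub>S\<^esub> conj_step m (head_mult b) = conj_step (m + 1) (head_mult b) \<otimes>\<^bsub>S\<^esub> step" for m
    using a b by (auto intro: step_conj_step)
  have zL: "conj_step m (head_mult a) [^]\<^bsub>S\<^esub> L = conj_step m (head_mult z)" for m
    using a z by (simp add: conj_step_pow head_mult_pow)
  have self: "comm_exp g g = 0" for g by (simp add: comm_exp_def)
  have "comm_exp b a = 1" by (rule comm_exp_unique) (use a b ba in auto)
  then show "conj_step m (head_mult b) \<otimes>\<^bsub>S\<^esub> conj_step n (head_mult a) =
      conj_step ((m + n) div 2) (head_mult a) [^]\<^bsub>S\<^esub> L \<otimes>\<^bsub>S\<^esub> conj_step n (head_mult a) \<otimes>\<^bsub>S\<^esub> conj_step m (head_mult b)" for m n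
    using head_mult_commutator[OF b a, of m n] by (simp add: zL)
  show "conj_step m (head_mult a) \<otimes>\<^bsub>S\<^esub> conj_step n (head_mult a) = conj_step n (head_mult a) \<otimes>\<^bsub>S\<^esub> conj_step m (head_mult a)" for m n
    using head_mult_commutator[OF a a, of m n] a by (simp add: self head_mult_one conj_step_one)
  show "conj_step m (head_mult b) \<otimes>\<^bsub>S\<^esub> conj_step n (head_mult b) = conj_step n (head_mult b) \<otimes>\<^bsub>S\<^esub> conj_step m (head_mult b)" for m n
    using head_mult_commutator[OF b b, of m n] b by (simp add: self head_mult_one conj_step_one)
  have "a [^] (2 * L) = \<one>" using a z z_sq by (simp add: mult_2 flip: nat_pow_mult)
  then show "conj_step m (head_mult a) [^]\<^bsub>S\<^esub> (2 * L) = \<one>\<^bsub>S\<^esub>" for m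
    using a by (simp add: conj_step_pow head_mult_pow head_mult_one conj_step_one)
  show "conj_step m (head_mult b) \<otimes>\<^bsub>S\<^esub> conj_step m (head_mult b) = (if \<epsilon> then conj_step m (head_mult a) [^]\<^bsub>S\<^esub> L else \<one>\<^bsub>S\<^esub>)" for m
    using b bb unfolding zL by (auto simp: head_mult_one conj_step_one simp flip: conj_step_mult head_mult_mult)
  show "list_prod S (\<lambda>m. conj_step m (head_mult a) [^]\<^bsub>S\<^esub> L) (q # qs) \<noteq> \<one>\<^bsub>S\<^esub>" if "\<And>r. r \<in> set qs \<Longrightarrow> q < r" for q qs
    unfolding zL using that by (rule leading_head_mult_z)
qed

end

section \<open>Matrices over Laurent polynomials satisfying the lamplighter relations\<close>

definition unit_vector :: "nat \<Rightarrow> nat \<Rightarrow> 'r::comm_ring_1" where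
  "unit_vector j k = (if k = j then 1 else 0)"

definition operator_mat :: "nat \<Rightarrow> ((nat \<Rightarrow> 'r::comm_ring_1) \<Rightarrow> nat \<Rightarrow> 'r) \<Rightarrow> 'r mat" where
  "operator_mat d P = mat d d (\<lambda>(i, j). P (unit_vector j) i)"

text \<open>Matrices are handled as maps on coordinate functions, so that relations become pointwise
  identities. The third clause keeps coordinates from \<open>d\<close> on out of the first
  \<open>d\<close> values, which makes composition agree with the matrix product.\<close>

definition linear_operator :: "nat \<Rightarrow> ((nat \<Rightarrow> 'r::comm_ring_1) \<Rightarrow> nat \<Rightarrow> 'r) \<Rightarrow> bool" where
  "linear_operator d P \<longleftrightarrow>
    (\<forall>f g. P (\<lambda>k. f k + g k) = (\<lambda>i. P f i + P g i)) \<and>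
    (\<forall>c f. P (\<lambda>k. c * f k) = (\<lambda>i. c * P f i)) \<and>
    (\<forall>f g i. i < d \<longrightarrow> (\<forall>k<d. f k = g k) \<longrightarrow> P f i = P g i)"

lemma linear_operator_sum:
  assumes "linear_operator d P"
  shows "P (\<lambda>k. \<Sum>j<(n::nat). c j * f j k) i = (\<Sum>j<n. c j * P (f j) i)"
proof (induction n)
  case 0
  have "P (\<lambda>k. c * f k) = (\<lambda>i. c * P f i)" for c f
    using assms unfolding linear_operator_def by blast
  from this[of 0 "\<lambda>k. 0"] show ?case by (simp add: fun_eq_iff)
next
  case (Suc n)
  have "P (\<lambda>k. g k + g' k) = (\<lambda>i. P g i + P g' i)" for g g'
    using assms unfolding linear_operator_def by blast
  from this[of "\<lambda>k. \<Sum>j<n. c j * f j k" "\<lambda>k. c n * f n k"]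
  have "P (\<lambda>k. (\<Sum>j<n. c j * f j k) + c n * f n k) = (\<lambda>i. P (\<lambda>k. \<Sum>j<n. c j * f j k) i + P (\<lambda>k. c n * f n k) i)" .
  moreover have "P (\<lambda>k. c n * f n k) = (\<lambda>i. c n * P (f n) i)"
    using assms unfolding linear_operator_def by blast
  ultimately show ?case using Suc by simp
qed

lemma linear_operator_expand:
  assumes "linear_operator d P" "i < d"
  shows "P f i = (\<Sum>k<d. P (unit_vector k) i * f k)"
proof -
  have "P f i = P (\<lambda>k. \<Sum>j<d. f j * unit_vector j k) i"
    using assms unfolding linear_operator_def by (auto simp: unit_vector_def if_distrib cong: if_cong)
  also have "\<dots> = (\<Sum>k<d. P (unit_vector k) i * f k)"
    using linear_operator_sum[OF assms(1)] by (simp add: mult.commute)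
  finally show ?thesis .
qed

lemma operator_mat_carrier [simp, intro]: "operator_mat d P \<in> carrier_mat d d"
  by (simp add: operator_mat_def)

lemma operator_mat_mult:
  assumes "linear_operator d P"
  shows "operator_mat d P * operator_mat d Q = operator_mat d (\<lambda>f. P (Q f))"
  by (rule eq_matI)
    (auto simp: operator_mat_def scalar_prod_def linear_operator_expand[OF assms, of _ "Q _"] lessThan_atLeast0)

lemma operator_mat_id: "operator_mat d (\<lambda>f. f) = 1\<^sub>m d"
  by (rule eq_matI) (auto simp: operator_mat_def unit_vector_def)

lemma linear_operator_id: "linear_operator d (\<lambda>f. f)"
  by (simp add: linear_operator_def)

lemma linear_operator_comp:
  "linear_operator d P \<Longrightarrow> linear_operator d Q \<Longrightarrow> linear_operator d (\<lambda>f. P (Q f))"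
  unfolding linear_operator_def by simp

lemma general_linear_simps [simp]:
  "(\<otimes>\<^bsub>general_linear TYPE('r::comm_ring_1) d\<^esub>) = (*)"
  "\<one>\<^bsub>general_linear TYPE('r) d\<^esub> = 1\<^sub>m d"
  by (simp_all add: general_linear_def units_of_def ring_mat_def)

lemma group_general_linear: "group (general_linear TYPE('r::comm_ring_1) d)"
proof -
  interpret ring "ring_mat TYPE('r) d ()" by (rule ring_mat)
  show ?thesis unfolding general_linear_def by (rule units_group)
qed

lemma operator_mat_general_linear:
  assumes "linear_operator d P" "linear_operator d Q" "\<And>f. P (Q f) = f" "\<And>f. Q (P f) = f"
  shows "operator_mat d P \<in> carrier (general_linear TYPE('r::comm_ring_1) d)"
  using operator_mat_mult[OF assms(1), of Q] operator_mat_mult[OF assms(2), of P]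
  by (auto simp: assms(3,4) operator_mat_id general_linear_def units_of_def Units_def ring_mat_def
      intro!: bexI[of _ "operator_mat d Q"])

lemma operator_mat_pow:
  assumes "linear_operator d P"
  shows "operator_mat d P [^]\<^bsub>general_linear TYPE('r::comm_ring_1) d\<^esub> (n::nat) = operator_mat d (P ^^ n)"
    and "linear_operator d (P ^^ n)"
proof -
  show lin: "linear_operator d (P ^^ n)" for n
  proof (induction n)
    case (Suc n)
    show ?case using linear_operator_comp[OF assms Suc] by (simp add: o_def)
  qed (simp add: linear_operator_id id_def)
  show "operator_mat d P [^]\<^bsub>general_linear TYPE('r) d\<^esub> (n::nat) = operator_mat d (P ^^ n)"
  proof (induction n)
    case 0
    then show ?case by (simp add: operator_mat_id id_def)
  next
    case (Suc n)
    then show ?case using operator_mat_mult[OF lin, of n P]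
      by (simp add: funpow_swap1 o_def)
  qed
qed

section \<open>Laurent polynomials over the field with two elements\<close>

definition t_pow :: "int \<Rightarrow> bit laurent_poly" where
  "t_pow m = Poly_Mapping.single m 1"

lemma laurent_add_self [simp]: "(p :: bit laurent_poly) + p = 0"
  by (rule poly_mapping_eqI) (simp only: lookup_add bit_add_self lookup_zero)

lemma laurent_two [simp]: "(2 :: bit laurent_poly) = 0"
  by (simp only: one_add_one[symmetric] laurent_add_self)

lemma laurent_add_left_self [simp]: "(p :: bit laurent_poly) + (p + q) = q"
  by (simp flip: add.assoc)

lemma t_pow_mult: "t_pow m * t_pow n = t_pow (m + n)"
  by (simp add: t_pow_def mult_single)

lemma t_pow_mult_left: "t_pow m * (t_pow n * p) = t_pow (m + n) * p"
  by (simp add: t_pow_mult flip: mult.assoc)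

lemma t_pow_0: "t_pow 0 = 1"
  by (simp add: t_pow_def single_one)

text \<open>
  With \<open>s = t\<^sup>L\<close>, conjugation by the image of \<open>x\<close> multiplies the corner entry \<open>(0, L)\<close> by \<open>s\<close>.
  Coordinates \<open>0, \<dots>, L\<close> carry a Jordan block, which makes \<open>A m\<close> of order \<open>2L\<close> with \<open>A m ^ L\<close> in the
  corner. Coordinates \<open>L + 1, L + 2\<close> carry a Heisenberg block on which \<open>x\<close> acts by a square root
  \<open>X\<close> of \<open>s\<close> that is not diagonalisable: pairing the row \<open>(1 1) X\<^sup>m\<close> of \<open>B m\<close> with the column \<open>X\<^sup>n e\<^sub>1\<close>
  of \<open>A n\<close> yields exactly \<open>s\<close> to the power \<open>\<lfloor>(m + n) / 2\<rfloor>\<close>. Coordinate \<open>L + 3\<close> makes \<open>B m\<close> a square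
  root of \<open>A m ^ L\<close> when \<open>\<epsilon>\<close> holds.
\<close>

locale lamp_matrices =
  fixes l :: nat and \<epsilon> :: bool
  assumes l_pos: "0 < l"
begin

abbreviation L :: nat where "L \<equiv> 2 ^ l"
abbreviation h :: int where "h \<equiv> 2 ^ (l - 1)"

lemma int_L: "int L = 2 * h"
  using l_pos by (cases l) auto

definition op_A :: "int \<Rightarrow> (nat \<Rightarrow> bit laurent_poly) \<Rightarrow> nat \<Rightarrow> bit laurent_poly" where
  "op_A m f i =
    (if i < L then f i + t_pow m * f (Suc i)
     else if i = L + 1 \<and> even m \<or> i = L + 2 \<and> odd m then f i + t_pow (int L * (m div 2)) * f L
     else f i)"

definition coeff_F :: "int \<Rightarrow> bit laurent_poly" where
  "coeff_F m = (if \<epsilon> then t_pow (h * m) else 0)"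

definition op_B :: "int \<Rightarrow> (nat \<Rightarrow> bit laurent_poly) \<Rightarrow> nat \<Rightarrow> bit laurent_poly" where
  "op_B m f i =
    (if i = 0 then f i + t_pow (int L * (m div 2)) * f (L + 1) + t_pow (int L * ((m + 1) div 2)) * f (L + 2)
       + coeff_F m * f (L + 3)
     else if i = L + 3 then f i + coeff_F m * f L
     else f i)"

text \<open>The weights t^(L - i) shift the superdiagonal of the Jordan block by t. As coordinate
  \<open>L\<close> has weight 1, the column of \<open>A m\<close> is just multiplied by X. As
  coordinate 0 has weight s = X^2, the row of \<open>B m\<close> is multiplied by s X^-1 = X. The
  weight t^\<open>h\<close> is a square root of s, so both entries \<open>coeff_F m\<close> are
  multiplied by t^\<open>h\<close>.\<close>

definition op_X :: "(nat \<Rightarrow> bit laurent_poly) \<Rightarrow> nat \<Rightarrow> bit laurent_poly" where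
  "op_X f i =
    (if i \<le> L then t_pow (int L - int i) * f i
     else if i = L + 1 then t_pow (int L) * f (L + 2)
     else if i = L + 2 then f (L + 1)
     else t_pow h * f i)"

definition op_X_inv :: "(nat \<Rightarrow> bit laurent_poly) \<Rightarrow> nat \<Rightarrow> bit laurent_poly" where
  "op_X_inv f i =
    (if i \<le> L then t_pow (int i - int L) * f i
     else if i = L + 1 then f (L + 2)
     else if i = L + 2 then t_pow (- int L) * f (L + 1)
     else t_pow (- h) * f i)"

definition op_corner :: "bit laurent_poly \<Rightarrow> (nat \<Rightarrow> bit laurent_poly) \<Rightarrow> nat \<Rightarrow> bit laurent_poly" where
  "op_corner c f i = (if i = 0 then f i + c * f L else f i)"

definition op_Z :: "int \<Rightarrow> (nat \<Rightarrow> bit laurent_poly) \<Rightarrow> nat \<Rightarrow> bit laurent_poly" where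
  "op_Z m = op_corner (t_pow (int L * m))"

abbreviation dim :: nat where "dim \<equiv> L + 4"

lemma linear_ops:
  "linear_operator dim (op_A m)" "linear_operator dim (op_B m)" "linear_operator dim op_X"
  "linear_operator dim op_X_inv" "linear_operator dim (op_Z m)"
  unfolding linear_operator_def op_A_def op_B_def op_X_def op_X_inv_def op_Z_def op_corner_def
  by (auto simp: fun_eq_iff algebra_simps)

lemma op_X_inverse: "op_X (op_X_inv f) = f" "op_X_inv (op_X f) = f"
  by (auto simp: fun_eq_iff op_X_def op_X_inv_def t_pow_mult_left t_pow_0)

lemma op_A_comm: "op_A m (op_A n f) = op_A n (op_A m f)"
  by (auto simp: fun_eq_iff op_A_def t_pow_mult_left distrib_left add_ac)

lemma op_B_comm: "op_B m (op_B n f) = op_B n (op_B m f)"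
  by (auto simp: fun_eq_iff op_B_def algebra_simps)

lemma coeff_F_sq: "coeff_F m * (coeff_F m * p) = (if \<epsilon> then t_pow (int L * m) * p else 0)"
proof -
  have "h * m + h * m = int L * m" unfolding int_L by simp
  then show ?thesis unfolding coeff_F_def by (cases \<epsilon>) (simp_all only: t_pow_mult_left if_True if_False mult_zero_left)
qed

text \<open>Off the diagonal, the only path of length two leads from coordinate \<open>L\<close> via
  \<open>L + 3\<close> to 0. The remaining terms occur twice and cancel.\<close>

lemma op_B_sq: "op_B m (op_B m f) = (if \<epsilon> then op_Z m f else f)"
proof
  fix i
  have "op_B m (op_B m f) i = (if i = 0 then f i + coeff_F m * (coeff_F m * f L) else f i)"
    by (auto simp: op_B_def distrib_left add_ac)
  then show "op_B m (op_B m f) i = (if \<epsilon> then op_Z m f else f) i"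
    unfolding coeff_F_sq by (auto simp: op_Z_def op_corner_def)
qed

text \<open>The two orders differ only by the path from coordinate \<open>L\<close> to 0 through the
  Heisenberg block. It passes \<open>L + 1\<close> for even \<open>n\<close> and
  \<open>L + 2\<close> for odd \<open>n\<close>, whence the case split on the parity of
  \<open>n\<close>.\<close>

lemma op_B_A: "op_B m (op_A n f) = op_Z ((m + n) div 2) (op_A n (op_B m f))"
proof
  fix i
  define u where "u = int L * (m div 2)"
  define u' where "u' = int L * ((m + 1) div 2)"
  define v where "v = int L * (n div 2)"
  define w where "w = int L * ((m + n) div 2)"
  have p: "even n \<Longrightarrow> (m + n) div 2 = m div 2 + n div 2" "odd n \<Longrightarrow> (m + n) div 2 = (m + 1) div 2 + n div 2"
    by presburger+
  have e: "even n \<Longrightarrow> w = u + v" "odd n \<Longrightarrow> w = u' + v"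
    unfolding u_def u'_def v_def w_def by (simp_all only: p distrib_left not_False_eq_True)
  show "op_B m (op_A n f) i = op_Z ((m + n) div 2) (op_A n (op_B m f)) i"
    unfolding op_B_def op_A_def op_Z_def op_corner_def u_def[symmetric] u'_def[symmetric] v_def[symmetric] w_def[symmetric]
    by (cases "even n") (auto simp: t_pow_mult_left distrib_left add_ac e)
qed

lemma op_X_A: "op_X (op_A m f) = op_A (m + 1) (op_X f)"
proof
  fix i
  have e: "even m \<Longrightarrow> (1 + m) div 2 = m div 2" "odd m \<Longrightarrow> (1 + m) div 2 = 1 + m div 2" by presburger+
  show "op_X (op_A m f) i = op_A (m + 1) (op_X f) i"
    by (auto simp: op_X_def op_A_def t_pow_mult_left distrib_left add_ac e)
qed

lemma op_X_B: "op_X (op_B m f) = op_B (m + 1) (op_X f)"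
proof
  fix i
  have e: "(m + 1 + 1) div 2 = m div 2 + 1" by presburger
  show "op_X (op_B m f) i = op_B (m + 1) (op_X f) i"
    using int_L
    by (auto simp: op_X_def op_B_def coeff_F_def t_pow_mult_left t_pow_mult distrib_left add_ac e)
qed

text \<open>In characteristic 2, (1 + N)^(2^j) = 1 + N^(2^j). The Heisenberg column dies already in
  N^2, as nothing leads on from coordinates \<open>L + 1\<close> and \<open>L + 2\<close>; hence
  \<open>0 < j\<close>.\<close>

lemma op_A_pow: "0 < j \<Longrightarrow> (op_A m ^^ (2 ^ j)) f i =
    (if i + 2 ^ j \<le> L then f i + t_pow (2 ^ j * m) * f (i + 2 ^ j) else f i)"
proof (induction j arbitrary: f i rule: nat_induct_non_zero)
  case 1
  have "L \<noteq> 1" using l_pos by (cases l) auto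
  then show ?case
    by (auto simp: numeral_2_eq_2 op_A_def t_pow_mult_left distrib_left add_ac)
next
  case (Suc j)
  have "(op_A m ^^ (2 ^ Suc j)) f i = (op_A m ^^ (2 ^ j)) ((op_A m ^^ (2 ^ j)) f) i"
    by (simp add: mult_2 funpow_add)
  also have "\<dots> = (if i + 2 ^ j + 2 ^ j \<le> L then f i + t_pow (2 ^ j * m + 2 ^ j * m) * f (i + 2 ^ j + 2 ^ j) else f i)"
    unfolding Suc.IH by (auto simp: t_pow_mult_left distrib_left add.assoc)
  also have "2 ^ j * m + 2 ^ j * m = 2 ^ Suc j * m" by simp
  also have "i + 2 ^ j + 2 ^ j = i + 2 ^ Suc j" by simp
  finally show ?case .
qed

lemma op_A_pow_L: "op_A m ^^ L = op_Z m"
  using op_A_pow[OF l_pos] by (auto simp: fun_eq_iff op_Z_def op_corner_def)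

lemma op_Z_sq: "op_Z m (op_Z m f) = f"
  by (auto simp: fun_eq_iff op_Z_def op_corner_def algebra_simps)

abbreviation GL :: "bit laurent_poly mat monoid" where
  "GL \<equiv> general_linear TYPE(bit laurent_poly) dim"

lemma op_A_inverse: "op_A m ((op_A m ^^ (2 * L - 1)) f) = f" "(op_A m ^^ (2 * L - 1)) (op_A m f) = f"
proof -
  have s: "Suc (2 * L - 1) = L + L" by simp
  have "(op_A m ^^ Suc (2 * L - 1)) f = f"
    unfolding s funpow_add op_A_pow_L by (simp add: op_Z_sq)
  then show "op_A m ((op_A m ^^ (2 * L - 1)) f) = f" "(op_A m ^^ (2 * L - 1)) (op_A m f) = f"
    by (simp_all only: funpow.simps(2) o_apply) (simp only: funpow_swap1)
qed

lemma op_B_inverse: "op_B m (op_B m (op_B m (op_B m f))) = f"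
  using op_Z_sq by (simp add: op_B_sq)

lemma op_corner_add: "op_corner c (op_corner c' f) = op_corner (c + c') f"
  by (auto simp: fun_eq_iff op_corner_def distrib_right add_ac)

lemma list_prod_op_Z:
  "list_prod GL (\<lambda>m. operator_mat dim (op_Z m)) qs = operator_mat dim (op_corner (\<Sum>q\<leftarrow>qs. t_pow (int L * q)))"
proof (induction qs)
  case Nil
  have "op_corner 0 = (\<lambda>f. f)"
    by (auto simp: fun_eq_iff op_corner_def)
  then show ?case by (simp add: operator_mat_id)
next
  case (Cons q qs)
  have "list_prod GL (\<lambda>m. operator_mat dim (op_Z m)) (q # qs) =
      operator_mat dim (\<lambda>f. op_Z q (op_corner (\<Sum>q\<leftarrow>qs. t_pow (int L * q)) f))"
    by (simp only: list_prod_simps Cons general_linear_simps operator_mat_mult[OF linear_ops(5)])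
  then show ?case by (simp only: op_Z_def op_corner_add list.map sum_list.Cons)
qed

lemma faithful_lamp_matrices:
  "faithful_lamp GL (operator_mat dim op_X) (\<lambda>m. operator_mat dim (op_A m)) (\<lambda>m. operator_mat dim (op_B m)) L \<epsilon>"
proof -
  interpret group GL by (rule group_general_linear)
  have pow: "operator_mat dim (op_A m) [^]\<^bsub>GL\<^esub> L = operator_mat dim (op_Z m)" for m
    by (simp only: operator_mat_pow linear_ops op_A_pow_L)
  have A: "operator_mat dim (op_A m) \<in> carrier GL" for m
    by (rule operator_mat_general_linear[where Q = "op_A m ^^ (2 * L - 1)"])
      (rule linear_ops op_A_inverse operator_mat_pow)+
  have B3: "linear_operator dim (\<lambda>f. op_B m (op_B m (op_B m f)))" for m
    by (rule linear_operator_comp[OF linear_ops(2) linear_operator_comp[OF linear_ops(2,2)]])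
  show ?thesis
  proof
    show "operator_mat dim op_X \<in> carrier GL"
      by (rule operator_mat_general_linear[OF linear_ops(3,4) op_X_inverse])
    show "operator_mat dim (op_A m) \<in> carrier GL" for m by (rule A)
    show "operator_mat dim (op_B m) \<in> carrier GL" for m
      by (rule operator_mat_general_linear[OF linear_ops(2) B3 op_B_inverse op_B_inverse])
    show "operator_mat dim op_X \<otimes>\<^bsub>GL\<^esub> operator_mat dim (op_A m) = operator_mat dim (op_A (m + 1)) \<otimes>\<^bsub>GL\<^esub> operator_mat dim op_X" for m
      by (simp add: operator_mat_mult linear_ops op_X_A)
    show "operator_mat dim op_X \<otimes>\<^bsub>GL\<^esub> operator_mat dim (op_B m) = operator_mat dim (op_B (m + 1)) \<otimes>\<^bsub>GL\<^esub> operator_mat dim op_X" for m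
      by (simp add: operator_mat_mult linear_ops op_X_B)
    show "operator_mat dim (op_A m) \<otimes>\<^bsub>GL\<^esub> operator_mat dim (op_A n) = operator_mat dim (op_A n) \<otimes>\<^bsub>GL\<^esub> operator_mat dim (op_A m)" for m n
      by (simp add: operator_mat_mult linear_ops op_A_comm[of m])
    show "operator_mat dim (op_B m) \<otimes>\<^bsub>GL\<^esub> operator_mat dim (op_B n) = operator_mat dim (op_B n) \<otimes>\<^bsub>GL\<^esub> operator_mat dim (op_B m)" for m n
      by (simp add: operator_mat_mult linear_ops op_B_comm[of m])
    show "operator_mat dim (op_B m) \<otimes>\<^bsub>GL\<^esub> operator_mat dim (op_A n) =
      operator_mat dim (op_A ((m + n) div 2)) [^]\<^bsub>GL\<^esub> L \<otimes>\<^bsub>GL\<^esub> operator_mat dim (op_A n) \<otimes>\<^bsub>GL\<^esub> operator_mat dim (op_B m)" for m n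
      unfolding pow
      by (simp add: operator_mat_mult linear_ops operator_mat_mult[OF linear_operator_comp[OF linear_ops(5,1)]] op_B_A)
    show "operator_mat dim (op_A m) [^]\<^bsub>GL\<^esub> (2 * L) = \<one>\<^bsub>GL\<^esub>" for m
    proof -
      have "operator_mat dim (op_A m) [^]\<^bsub>GL\<^esub> (2 * L) = operator_mat dim (op_Z m) \<otimes>\<^bsub>GL\<^esub> operator_mat dim (op_Z m)"
        unfolding mult_2 using A nat_pow_mult[OF A, of m L L] by (simp only: pow)
      then show ?thesis by (simp add: operator_mat_mult linear_ops op_Z_sq operator_mat_id)
    qed
    show "operator_mat dim (op_B m) \<otimes>\<^bsub>GL\<^esub> operator_mat dim (op_B m) =
        (if \<epsilon> then operator_mat dim (op_A m) [^]\<^bsub>GL\<^esub> L else \<one>\<^bsub>GL\<^esub>)" for m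
      unfolding pow by (simp add: operator_mat_mult linear_ops op_B_sq operator_mat_id)
    show "even L" "0 < L" using l_pos by auto
    show "list_prod GL (\<lambda>m. operator_mat dim (op_A m) [^]\<^bsub>GL\<^esub> L) (q # qs) \<noteq> \<one>\<^bsub>GL\<^esub>"
      if less: "\<And>r. r \<in> set qs \<Longrightarrow> q < r" for q qs
    proof
      assume "list_prod GL (\<lambda>m. operator_mat dim (op_A m) [^]\<^bsub>GL\<^esub> L) (q # qs) = \<one>\<^bsub>GL\<^esub>"
      then have "operator_mat dim (op_corner (\<Sum>r\<leftarrow>q # qs. t_pow (int L * r))) = 1\<^sub>m dim"
        unfolding pow list_prod_op_Z by simp
      \<comment> \<open>The corner entry collects one power of t for each index; all others exceed
        \<open>q\<close>, so the coefficient at \<open>int L * q\<close> is 1.\<close>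
      from arg_cong[OF this, of "\<lambda>M. M $$ (0, L)"]
      have "t_pow (int L * q) + (\<Sum>r\<leftarrow>qs. t_pow (int L * r)) = 0"
        by (simp add: operator_mat_def unit_vector_def op_corner_def)
      from arg_cong[OF this, of "\<lambda>p. poly_mapping.lookup p (int L * q)"]
      have "1 + poly_mapping.lookup (\<Sum>r\<leftarrow>qs. t_pow (int L * r)) (int L * q) = (0::bit)"
        by (simp only: lookup_add t_pow_def lookup_single_eq lookup_zero)
      moreover have "poly_mapping.lookup (\<Sum>r\<leftarrow>qs. t_pow (int L * r)) (int L * q) = (0::bit)"
        using less
      proof (induction qs)
        case (Cons r qs)
        then have "int L * r \<noteq> int L * q" by force
        moreover have "poly_mapping.lookup (\<Sum>r\<leftarrow>qs. t_pow (int L * r)) (int L * q) = (0::bit)"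
          using Cons by simp
        ultimately show ?case
          by (simp only: list.map sum_list.Cons lookup_add t_pow_def lookup_single_not_eq[OF \<open>int L * r \<noteq> int L * q\<close>] add_0)
      qed simp
      ultimately show False by simp
    qed
  qed
qed

end

section \<open>Quaternion and modular groups\<close>

lemma (in central_commutator_group) linear_automaton:
  assumes a: "a \<in> carrier G" and b: "b \<in> carrier G" and gen: "carrier G \<subseteq> generate G {a, b}"
    and z: "a [^] ((2::nat) ^ l) = z" and l: "0 < l"
    and ba: "b \<otimes> a = z \<otimes> (a \<otimes> b)" and bb: "b \<otimes> b = (if \<epsilon> then z else \<one>)"
  shows "linear_over TYPE(bit laurent_poly) (automata_group (cayley_machine G))"
proof -
  interpret M: lamp_matrices l \<epsilon> by unfold_locales (rule l)
  let ?H = "generate S {step, head_mult a, head_mult b}"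
  have "faithful_lamp S step (\<lambda>m. conj_step m (head_mult a)) (\<lambda>m. conj_step m (head_mult b)) (2 ^ l) \<epsilon>"
    using l by (intro faithful_lamp_automaton[OF a b z ba bb]) auto
  from faithful_lamp_embedding[OF this M.faithful_lamp_matrices HOL.refl]
  obtain \<phi> where \<phi>: "\<phi> \<in> mon (S\<lparr>carrier := ?H\<rparr>) M.GL"
    using a b by (auto simp: conj_step_zero)
  have H: "subgroup ?H S"
    using a b by (intro S.generate_is_subgroup) auto
  interpret h: group_hom G S head_mult
    by unfold_locales (auto simp: hom_def head_mult_mult)
  have head: "head_mult g \<in> ?H" if "g \<in> generate G {a, b}" for g
    using that
  proof (induction rule: generate.induct)
    case one
    then show ?case by (simp add: head_mult_one generate.one)
  next
    case (incl g)
    then show ?case by (auto intro: generate.incl)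
  next
    case (inv g)
    then have "g \<in> carrier G" using a b by auto
    then show ?case using inv by (auto intro: generate.inv)
  next
    case (eng g g')
    then have "g \<in> carrier G" "g' \<in> carrier G" using generate_in_carrier[of "{a, b}"] a b by auto
    then show ?case using eng by (auto intro: generate.eng)
  qed
  \<comment> \<open>Each state acts as \<open>step\<close> times \<open>head_mult g\<close>, and
    \<open>head_mult\<close> is a homomorphism on a group generated by \<open>a\<close> and
    \<open>b\<close>.\<close>
  have "state_action (cayley_machine G) g \<in> ?H" if "g \<in> carrier G" for g
    using generate.eng[OF generate.incl[of step] head[of g]] gen that
    by (auto simp flip: step_head_mult)
  then have sub: "generate S (state_action (cayley_machine G) ` carrier G) \<subseteq> ?H"
    by (intro S.generate_subgroup_incl[OF _ H]) auto
  have "automata_group (cayley_machine G) = S\<lparr>carrier := generate S (state_action (cayley_machine G) ` carrier G)\<rparr>"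
    by (simp add: automata_group_def Let_def cayley_machine_def)
  moreover have "\<phi> \<in> mon (S\<lparr>carrier := generate S (state_action (cayley_machine G) ` carrier G)\<rparr>) M.GL"
    using \<phi> sub by (auto simp: mon_def hom_def Pi_def subset_iff intro: inj_on_subset)
  ultimately show ?thesis
    unfolding linear_over_def by (intro exI[of _ "2 ^ l + 4"] conjI exI[of _ \<phi>]) auto
qed

text \<open>Commuting with \<open>z\<close>, and commuting with a fixed \<open>h\<close> up to
  \<open>z\<close>, both define subgroups, so generators suffice. For commutators this is used
  twice: first with \<open>h\<close> equal to \<open>a\<close> or \<open>b\<close>, then, by
  symmetry, with arbitrary \<open>h\<close>.\<close>

lemma (in group) central_commutator_group_from_generators:
  assumes a: "a \<in> carrier G" and b: "b \<in> carrier G" and gen: "carrier G \<subseteq> generate G {a, b}"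
    and z: "z \<in> carrier G" "z \<noteq> \<one>" "z \<otimes> z = \<one>" "a \<otimes> z = z \<otimes> a" "b \<otimes> z = z \<otimes> b"
    and ba: "b \<otimes> a = z \<otimes> (a \<otimes> b)"
  shows "central_commutator_group G z"
proof -
  have gen_closed: "g \<in> P" if "subgroup P G" "a \<in> P" "b \<in> P" "g \<in> carrier G" for g P
    using generate_subgroup_incl[of "{a, b}" P] that gen by auto
  have "subgroup {g \<in> carrier G. g \<otimes> z = z \<otimes> g} G"
  proof (rule subgroupI)
    fix g assume "g \<in> {g \<in> carrier G. g \<otimes> z = z \<otimes> g}"
    then show "inv g \<in> {g \<in> carrier G. g \<otimes> z = z \<otimes> g}"
      using z by simp (metis inv_closed inv_solve_left inv_solve_right m_assoc m_closed)
  next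
    fix g g' assume "g \<in> {g \<in> carrier G. g \<otimes> z = z \<otimes> g}" "g' \<in> {g \<in> carrier G. g \<otimes> z = z \<otimes> g}"
    then show "g \<otimes> g' \<in> {g \<in> carrier G. g \<otimes> z = z \<otimes> g}"
      using z by simp (metis m_assoc)
  qed (use z in auto)
  then have central: "g \<otimes> z = z \<otimes> g" if "g \<in> carrier G" for g
    using gen_closed[of "{g \<in> carrier G. g \<otimes> z = z \<otimes> g}" g] that a b z by auto
  define C where "C g h \<longleftrightarrow> g \<otimes> h = h \<otimes> g \<or> g \<otimes> h = z \<otimes> (h \<otimes> g)" for g h
  have C_sym: "C h g" if "C g h" "g \<in> carrier G" "h \<in> carrier G" for g h
  proof -
    have "z \<otimes> (z \<otimes> (h \<otimes> g)) = h \<otimes> g" using z that by (simp flip: m_assoc)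
    then show ?thesis using that unfolding C_def by metis
  qed
  have C_iff: "C g h \<longleftrightarrow> (\<exists>e \<in> {\<one>, z}. g \<otimes> h = e \<otimes> (h \<otimes> g))" if "g \<in> carrier G" "h \<in> carrier G" for g h
    using that by (auto simp: C_def)
  have C_sub: "subgroup {g \<in> carrier G. C g h} G" if h: "h \<in> carrier G" for h
  proof (rule subgroupI)
    fix g assume "g \<in> {g \<in> carrier G. C g h}"
    then obtain e where g: "g \<in> carrier G" and e: "e \<in> {\<one>, z}" "g \<otimes> h = e \<otimes> (h \<otimes> g)"
      using C_iff[OF _ h] by auto
    have e': "e \<in> carrier G" "inv g \<otimes> e = e \<otimes> inv g"
      using e z central[of "inv g"] g by auto
    have "h \<otimes> inv g = inv g \<otimes> (g \<otimes> h) \<otimes> inv g" using g h by (simp flip: m_assoc)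
    also have "\<dots> = inv g \<otimes> e \<otimes> h" unfolding e(2) using g h e'(1) by (simp add: m_assoc)
    also have "\<dots> = e \<otimes> (inv g \<otimes> h)"
      using arg_cong[OF e'(2), of "\<lambda>y. y \<otimes> h"] g h e'(1) by (simp add: m_assoc)
    finally have "C h (inv g)" using e g h C_iff[of h "inv g"] by auto
    then show "inv g \<in> {g \<in> carrier G. C g h}" using C_sym g h by auto
  next
    fix g g' assume "g \<in> {g \<in> carrier G. C g h}" "g' \<in> {g \<in> carrier G. C g h}"
    then have g: "g \<in> carrier G" "g' \<in> carrier G" and C: "C g h" "C g' h" by auto
    obtain e where e: "e \<in> {\<one>, z}" "g \<otimes> h = e \<otimes> (h \<otimes> g)"
      using C(1) C_iff[OF g(1) h] by blast
    obtain e' where e': "e' \<in> {\<one>, z}" "g' \<otimes> h = e' \<otimes> (h \<otimes> g')"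
      using C(2) C_iff[OF g(2) h] by blast
    have c: "e \<in> carrier G" "e' \<in> carrier G" "g \<otimes> e' = e' \<otimes> g"
      using e e' z central[of g] g by auto
    have "g \<otimes> g' \<otimes> h = (g \<otimes> e') \<otimes> (h \<otimes> g')" using g h c(1,2) e'(2) by (simp add: m_assoc)
    also have "\<dots> = e' \<otimes> ((g \<otimes> h) \<otimes> g')" unfolding c(3) using g h c by (simp add: m_assoc)
    also have "\<dots> = (e' \<otimes> e) \<otimes> (h \<otimes> (g \<otimes> g'))" unfolding e(2) using g h c by (simp add: m_assoc)
    finally have "C (g \<otimes> g') h"
      using C_iff[of "g \<otimes> g'" h] g h e(1) e'(1) z by auto
    then show "g \<otimes> g' \<in> {g \<in> carrier G. C g h}" using g by auto
  qed (use h in \<open>auto simp: C_def\<close>)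
  have "C b a" "C a a" "C b b" using ba by (auto simp: C_def)
  then have gens: "C g a" "C g b" if "g \<in> carrier G" for g
    using gen_closed[OF C_sub[OF a], of g] gen_closed[OF C_sub[OF b], of g] C_sym[of b a] a b that by auto
  have "C g h" if g: "g \<in> carrier G" and h: "h \<in> carrier G" for g h
    using gen_closed[OF C_sub[OF h], of g] C_sym[OF gens(1)[OF h] h a] C_sym[OF gens(2)[OF h] h b] a b g by auto
  then show ?thesis
    using z(1-3) central unfolding C_def by unfold_locales blast+
qed

section \<open>Evaluation of group words\<close>

definition eval_letter :: "('a, 'b) monoid_scheme \<Rightarrow> ('s \<Rightarrow> 'a) \<Rightarrow> 's \<times> bool \<Rightarrow> 'a" where
  "eval_letter G f x = (if snd x then f (fst x) else inv\<^bsub>G\<^esub> f (fst x))"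

text \<open>Von Dyck's principle: elements satisfying the relations define a homomorphism from the
  presented group. It serves to show that a word is not trivial.\<close>

lemma (in group) word_eq_eval:
  assumes "word_eq R u v" and f: "\<And>s. f s \<in> carrier G"
    and R: "\<And>u v. (u, v) \<in> R \<Longrightarrow> list_prod G (eval_letter G f) u = list_prod G (eval_letter G f) v"
  shows "list_prod G (eval_letter G f) u = list_prod G (eval_letter G f) v"
proof -
  have letter: "eval_letter G f x \<in> carrier G" for x
    using f by (simp add: eval_letter_def)
  have app: "list_prod G (eval_letter G f) (u @ v) = list_prod G (eval_letter G f) u \<otimes> list_prod G (eval_letter G f) v" for u v
    by (induction u) (simp_all add: letter list_prod_closed m_assoc)
  show ?thesis
    using assms(1)
  proof (induction rule: word_eq.induct)
    case (cancel s b)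
    then show ?case using f by (simp add: eval_letter_def)
  qed (simp_all add: R app)
qed

lemma list_prod_replicate:
  assumes "monoid G" "f x \<in> carrier G"
  shows "list_prod G f (replicate n x) = f x [^]\<^bsub>G\<^esub> n"
proof -
  interpret monoid G by (rule assms)
  show ?thesis
  proof (induction n)
    case (Suc n)
    then show ?case using nat_pow_Suc2[OF assms(2), of n] by simp
  qed simp
qed

text \<open>With a = i, b = j and z = -1 one has i^2 = j^2 = z and j i = z i j, so
  \<open>L = 2\<close> and \<open>\<epsilon>\<close> holds.\<close>

lemma linear_quaternion_automaton:
  "linear_over TYPE(bit laurent_poly) (automata_group (cayley_machine quaternion_group))"
proof -
  let ?G = quaternion_group and ?i = "(False, QI)" and ?j = "(False, QJ)" and ?z = "(True, Q1)"
  interpret group ?G by (rule group_quaternion_group)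
  have carr: "g \<in> carrier ?G" for g by (simp add: quaternion_group_def)
  have gen: "carrier ?G \<subseteq> generate ?G {?i, ?j}"
  proof
    fix g assume "g \<in> carrier ?G"
    let ?H = "generate ?G {?i, ?j}"
    have i: "?i \<in> ?H" and j: "?j \<in> ?H" by (auto intro: generate.incl)
    have one: "(False, Q1) \<in> ?H" using generate.one[of ?G "{?i, ?j}"] by (simp add: quaternion_group_def)
    have k: "(False, QK) \<in> ?H" using generate.eng[OF i j] by (simp add: quaternion_group_def)
    have z: "?z \<in> ?H" using generate.eng[OF i i] by (simp add: quaternion_group_def)
    have pos: "(False, u) \<in> ?H" for u by (cases u) (use one i j k in auto)
    have "(True, u) \<in> ?H" for u
      using generate.eng[OF z pos[of u]] by (simp add: quaternion_group_def)
    then show "g \<in> ?H" using pos by (cases g; cases "fst g") auto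
  qed
  interpret central_commutator_group ?G ?z
    by (rule central_commutator_group_from_generators[OF carr carr gen carr]) (auto simp: quaternion_group_def)
  show ?thesis
    by (rule linear_automaton[OF carr carr gen, where l = 1 and \<epsilon> = True])
      (auto simp: quaternion_group_def numeral_2_eq_2 nat_pow_def)
qed

lemma linear_modular_automaton:
  assumes "3 \<le> n"
  shows "linear_over TYPE(bit laurent_poly) (automata_group (cayley_machine (modular_group n)))"
proof -
  define l where "l = n - 2"
  define L :: nat where "L = 2 ^ l"
  have l: "0 < l" and n1: "2 ^ (n - 1) = 2 * L" and n2: "2 ^ (n - 2) = L"
    using assms by (auto simp: l_def L_def Suc_diff_Suc numeral_2_eq_2 numeral_3_eq_3 simp flip: power_Suc)
  have evenL: "even L" using l by (simp add: L_def)
  define R where "R = {(replicate (2 * L) (Gen_a, True), []),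
     (replicate 2 (Gen_b, True), []),
     ([(Gen_b, True), (Gen_a, True), (Gen_b, False)], replicate (L + 1) (Gen_a, True))}"
  have G: "modular_group n = presented_group R"
    unfolding modular_group_def R_def n1 n2 ..
  interpret group "presented_group R" by (rule group_presented_group)
  let ?G = "presented_group R"
  define cls where "cls u = word_rel R `` {u}" for u
  have cls_carr: "cls u \<in> carrier ?G" for u
    by (auto simp: cls_def presented_group_def quotient_def)
  have cls_ex: "\<exists>u. X = cls u" if "X \<in> carrier ?G" for X
    using that by (auto simp: cls_def presented_group_def quotient_def)
  have cls_mult: "cls u \<otimes>\<^bsub>?G\<^esub> cls v = cls (u @ v)" for u v
    by (simp add: cls_def presented_group_mult)
  have cls_one: "\<one>\<^bsub>?G\<^esub> = cls []" by (simp add: cls_def presented_group_def)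
  have cls_eq: "cls u = cls v \<longleftrightarrow> word_eq R u v" for u v
    unfolding cls_def using eq_equiv_class_iff[OF equiv_word_rel, of u v R] by (simp add: word_rel_def)
  define a where "a = cls [(Gen_a, True)]"
  define b where "b = cls [(Gen_b, True)]"
  have a: "a \<in> carrier ?G" and b: "b \<in> carrier ?G" by (auto simp: a_def b_def cls_carr)
  have a_pow: "cls (replicate k (Gen_a, True)) = a [^]\<^bsub>?G\<^esub> k" for k
  proof (induction k)
    case (Suc k)
    have "cls (replicate k (Gen_a, True)) \<otimes>\<^bsub>?G\<^esub> a = cls (replicate (Suc k) (Gen_a, True))"
      by (simp only: a_def cls_mult replicate_append_same replicate.simps)
    then show ?case by (simp add: Suc)
  qed (simp add: cls_one)
  have inv_cls: "cls [(s, False)] = inv\<^bsub>?G\<^esub> cls [(s, True)]" for s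
    using word_eq.cancel[of R s False] by (intro inv_equality[symmetric]) (auto simp: cls_mult cls_one cls_eq cls_carr)
  have a_order: "a [^]\<^bsub>?G\<^esub> (2 * L) = \<one>\<^bsub>?G\<^esub>"
    unfolding a_pow[symmetric] cls_one cls_eq by (rule word_eq.relation) (simp add: R_def)
  have bb: "b \<otimes>\<^bsub>?G\<^esub> b = \<one>\<^bsub>?G\<^esub>"
    unfolding b_def cls_mult cls_one cls_eq by (rule word_eq.relation) (simp add: R_def numeral_2_eq_2)
  have "b \<otimes>\<^bsub>?G\<^esub> a \<otimes>\<^bsub>?G\<^esub> inv\<^bsub>?G\<^esub> b = a [^]\<^bsub>?G\<^esub> (L + 1)"
    unfolding a_pow[symmetric] unfolding a_def b_def inv_cls[symmetric] cls_mult cls_eq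
    by (rule word_eq.relation) (simp add: R_def)
  then have ba1: "b \<otimes>\<^bsub>?G\<^esub> a = a [^]\<^bsub>?G\<^esub> (L + 1) \<otimes>\<^bsub>?G\<^esub> b"
    using a b by (metis inv_solve_right m_closed nat_pow_closed)
  define z where "z = a [^]\<^bsub>?G\<^esub> L"
  have z: "z \<in> carrier ?G" using a by (simp add: z_def)
  have zz: "z \<otimes>\<^bsub>?G\<^esub> z = \<one>\<^bsub>?G\<^esub>"
    using a a_order by (simp add: z_def nat_pow_mult mult_2)
  have ba: "b \<otimes>\<^bsub>?G\<^esub> a = z \<otimes>\<^bsub>?G\<^esub> (a \<otimes>\<^bsub>?G\<^esub> b)"
    unfolding ba1 z_def using a b by (simp add: m_assoc)
  have az: "a \<otimes>\<^bsub>?G\<^esub> z = z \<otimes>\<^bsub>?G\<^esub> a"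
    unfolding z_def using a by (simp add: group_commutes_pow)
  have "b \<otimes>\<^bsub>?G\<^esub> a [^]\<^bsub>?G\<^esub> k = a [^]\<^bsub>?G\<^esub> ((L + 1) * k) \<otimes>\<^bsub>?G\<^esub> b" for k
  proof (induction k)
    case (Suc k)
    have "b \<otimes>\<^bsub>?G\<^esub> a [^]\<^bsub>?G\<^esub> Suc k = b \<otimes>\<^bsub>?G\<^esub> a [^]\<^bsub>?G\<^esub> k \<otimes>\<^bsub>?G\<^esub> a"
      using a b by (simp add: m_assoc)
    also have "\<dots> = a [^]\<^bsub>?G\<^esub> ((L + 1) * k) \<otimes>\<^bsub>?G\<^esub> (b \<otimes>\<^bsub>?G\<^esub> a)"
      unfolding Suc using a b by (simp add: m_assoc)
    also have "\<dots> = a [^]\<^bsub>?G\<^esub> ((L + 1) * k + (L + 1)) \<otimes>\<^bsub>?G\<^esub> b"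
      unfolding ba1 using a b by (simp only: nat_pow_mult[symmetric] m_assoc nat_pow_closed m_closed)
    finally show ?case by (simp add: add.commute)
  qed (use b in simp)
  \<comment> \<open>Conjugation by \<open>b\<close> takes a^L to a^((L + 1) L), which equals a^L
    because \<open>L\<close> is even and a^(2 L) is trivial. Hence \<open>z\<close> commutes with
    \<open>b\<close>.\<close>
  moreover have "a [^]\<^bsub>?G\<^esub> ((L + 1) * L) = z"
  proof -
    obtain k where "L = 2 * k" using evenL by blast
    then have eq: "(L + 1) * L = 2 * L * k + L" by simp
    have "a [^]\<^bsub>?G\<^esub> (2 * L * k + L) = (a [^]\<^bsub>?G\<^esub> (2 * L)) [^]\<^bsub>?G\<^esub> k \<otimes>\<^bsub>?G\<^esub> a [^]\<^bsub>?G\<^esub> L"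
      by (simp only: nat_pow_pow nat_pow_mult a nat_pow_closed)
    then show ?thesis unfolding eq a_order using z by (simp add: z_def)
  qed
  ultimately have bz: "b \<otimes>\<^bsub>?G\<^esub> z = z \<otimes>\<^bsub>?G\<^esub> b" by (metis z_def)
  have gen: "carrier ?G \<subseteq> generate ?G {a, b}"
  proof
    fix X assume "X \<in> carrier ?G"
    then obtain u where X: "X = cls u" using cls_ex by blast
    have letter: "cls [x] \<in> generate ?G {a, b}" for x
    proof -
      obtain s c where x: "x = (s, c)" by fastforce
      have "cls [(s, True)] \<in> {a, b}" by (cases s) (auto simp: a_def b_def)
      then show ?thesis
        unfolding x by (cases c) (auto simp: inv_cls intro: generate.incl generate.inv)
    qed
    have "cls u \<in> generate ?G {a, b}"
    proof (induction u)
      case Nil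
      then show ?case using generate.one[of ?G] by (simp add: cls_one)
    next
      case (Cons x u)
      then show ?case using generate.eng[OF letter[of x] Cons] by (simp add: cls_mult)
    qed
    then show "X \<in> generate ?G {a, b}" by (simp add: X)
  qed
  \<comment> \<open>A presentation may collapse, so a model is required. The matrices for
    \<open>a\<close> and \<open>b\<close> at index 0 with \<open>\<epsilon>\<close> false satisfy
    the relations, and there a^L is not trivial.\<close>
  have "z \<noteq> \<one>\<^bsub>?G\<^esub>"
  proof
    assume "z = \<one>\<^bsub>?G\<^esub>"
    then have eq: "word_eq R (replicate L (Gen_a, True)) []"
      unfolding z_def a_pow[symmetric] cls_one cls_eq .
    interpret M: lamp_matrices l False by unfold_locales (rule l)
    let ?A = "operator_mat (2 ^ l + 4) (M.op_A 0)" and ?B = "operator_mat (2 ^ l + 4) (M.op_B 0)"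
    interpret F: faithful_lamp M.GL "operator_mat (2 ^ l + 4) M.op_X" "\<lambda>m. operator_mat (2 ^ l + 4) (M.op_A m)"
      "\<lambda>m. operator_mat (2 ^ l + 4) (M.op_B m)" L False
      unfolding L_def by (rule M.faithful_lamp_matrices)
    define f where "f s = (case s of Gen_a \<Rightarrow> ?A | Gen_b \<Rightarrow> ?B)" for s
    have f: "f s \<in> carrier M.GL" for s
      using F.A_closed[of 0] F.B_closed[of 0] by (cases s) (simp_all add: f_def)
    have rep: "list_prod M.GL (eval_letter M.GL f) (replicate k (Gen_a, True)) = ?A [^]\<^bsub>M.GL\<^esub> k" for k
      using list_prod_replicate[OF F.is_monoid, of "eval_letter M.GL f" "(Gen_a, True)" k] f[of Gen_a]
      by (simp add: eval_letter_def f_def)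
    have BA: "?B \<otimes>\<^bsub>M.GL\<^esub> ?A = ?A [^]\<^bsub>M.GL\<^esub> (L + 1) \<otimes>\<^bsub>M.GL\<^esub> ?B"
      using F.B_A[of 0 0] by (simp del: general_linear_simps)
    have "list_prod M.GL (eval_letter M.GL f) u = list_prod M.GL (eval_letter M.GL f) v" if uv: "(u, v) \<in> R" for u v
    proof -
      consider "u = replicate (2 * L) (Gen_a, True)" "v = []" | "u = replicate 2 (Gen_b, True)" "v = []"
        | "u = [(Gen_b, True), (Gen_a, True), (Gen_b, False)]" "v = replicate (L + 1) (Gen_a, True)"
        using uv unfolding R_def by blast
      then show ?thesis
      proof cases
        case 1
        then show ?thesis using F.A_pow[of 0] by (simp only: rep list_prod_simps)
      next
        case 2
        have "replicate 2 (Gen_b, True) = [(Gen_b, True), (Gen_b, True)]" by (simp add: numeral_2_eq_2)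
        then have "list_prod M.GL (eval_letter M.GL f) u = ?B \<otimes>\<^bsub>M.GL\<^esub> (?B \<otimes>\<^bsub>M.GL\<^esub> \<one>\<^bsub>M.GL\<^esub>)"
          by (simp add: 2 eval_letter_def f_def del: general_linear_simps)
        then show ?thesis by (simp only: 2 list_prod_simps F.r_one F.B_closed F.B_sq if_False)
      next
        case 3
        have "?B \<otimes>\<^bsub>M.GL\<^esub> (?A \<otimes>\<^bsub>M.GL\<^esub> inv\<^bsub>M.GL\<^esub> ?B) = (?B \<otimes>\<^bsub>M.GL\<^esub> ?A) \<otimes>\<^bsub>M.GL\<^esub> inv\<^bsub>M.GL\<^esub> ?B"
          using F.A_closed[of 0] F.B_closed[of 0] by (simp only: F.m_assoc F.inv_closed)
        also have "\<dots> = ?A [^]\<^bsub>M.GL\<^esub> (L + 1)"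
          unfolding BA using F.A_closed[of 0] F.B_closed[of 0]
          by (simp only: F.m_assoc F.inv_closed F.nat_pow_closed F.r_inv F.r_one)
        finally show ?thesis
          unfolding 3 rep using F.B_closed[of 0]
          by (simp add: eval_letter_def f_def del: general_linear_simps F.nat_pow_Suc)
      qed
    qed
    from F.word_eq_eval[OF eq f this] have "?A [^]\<^bsub>M.GL\<^esub> L = \<one>\<^bsub>M.GL\<^esub>"
      by (simp only: rep list_prod_simps)
    then show False
      using F.leading_term[of "[]" 0] F.A_closed[of 0] by (simp del: general_linear_simps)
  qed
  then interpret central_commutator_group ?G z
    using central_commutator_group_from_generators[OF a b gen z] zz az bz ba by blast
  show ?thesis
    unfolding G
    by (rule linear_automaton[OF a b gen _ l ba, where \<epsilon> = False]) (simp_all add: z_def L_def bb)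
qed

theorem theorem1p5:
  shows "linear_over TYPE(bit laurent_poly) (automata_group (cayley_machine quaternion_group)) \<and>
    (\<forall>n\<ge>3. linear_over TYPE(bit laurent_poly) (automata_group (cayley_machine (modular_group n))))"
  using linear_quaternion_automaton linear_modular_automaton by blast

end
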